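(* Let $\Omega=(B,\mathbf x,R,\mathbf Z)$ be a seed of rank $3$ with irreducible exchange matrix $B$, and suppose $\mu_1,\mu_2,\mu_3\in\mathcal S(\Omega)$. Then $\mathbb Q[\mathbf x^{\pm}]^{\langle\mu_1,\mu_2,\mu_3\rangle}\ne\mathbb Q$ if and only if $\Omega=\sigma(\Omega_{3,i})$ for some $i\in[1,10]$ and some $\sigma\in\mathfrak S_3$, where $\Omega_{3,1},\dots,\Omega_{3,10}$ are the seeds listed in the context.
   Context: Seeds (rank 3). A seed is $\Omega=(B,\mathbf x,R,\mathbf Z)$: $B=(b_{ij})$ is a $3\times3$ skew-symmetrizable integer matrix (the exchange matrix), i.e. $SB$ is skew-symmetric for some positive integer diagonal matrix $S$; $\mathbf x=(x_1,x_2,x_3)$ is a tuple of free generators of the ambient field of rational functions in three variables over $\mathbb Q$ (the cluster); $R=\mathrm{diag}(r_1,r_2,r_3)$ with positive integers $r_i$; $\mathbf Z=(Z_1,Z_2,Z_3)$ with $Z_k(u)=\sum_{i=0}^{r_k}z_{k,i}u^i\in\mathbb Z_{\ge0}[u]$, $z_{k,i}=z_{k,r_k-i}$, $z_{k,0}=z_{k,r_k}=1$. Mutations and permutations. With $B_s=(b_{1s},b_{2s},b_{3s})$ and $[\cdot]_+=\max\{\cdot,0\}$ componentwise, put $P_{\Omega,s}(\mathbf x)=\sum_{i=0}^{r_s}z_{s,i}\mathbf x^{i[B_s]_++(r_s-i)[-B_s]_+}$. The mutation is $\mu_s(B,\mathbf x,R,\mathbf Z)=(B',\mathbf x',R,\mathbf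 Z)$ with $b'_{ij}=-b_{ij}$ if $i=s$ or $j=s$, $b'_{ij}=b_{ij}+r_s([b_{is}]_+b_{sj}+b_{is}[-b_{sj}]_+)$ otherwise, $x'_s=P_{\Omega,s}(\mathbf x)/x_s$, and $x'_j=x_j$ for $j\ne s$. A permutation $\sigma\in\mathfrak S_3$ acts by $\sigma(B,\mathbf x,R,\mathbf Z)=((b_{\sigma(i)\sigma(j)}),(x_{\sigma(i)}),\mathrm{diag}(r_{\sigma(i)}),(Z_{\sigma(i)}))$. $\mathcal S(\Omega)$ is the set of all $\sigma\mu_s$ ($\sigma\in\mathfrak S_3$, $s\in\{1,2,3\}$) with $\sigma\mu_s(B,\mathbf x,R,\mathbf Z)=(\pm B,\mathbf x',R,\mathbf Z)$ for some $\mathbf x'$; in particular $\mu_s\in\mathcal S(\Omega)$ iff $\mu_s(B)=\pm B$. $\mathbb Q[\mathbf x^{\pm}]^{\langle\mu_1,\mu_2,\mu_3\rangle}$ is the ring of Laurent polynomials $F\in\mathbb Q[\mathbf x^{\pm}]$ with $F(g(\mathbf x))=F(\mathbf x)$ for all $g$ in the group generated by $\mu_1,\mu_2,\mu_3$, regarded as transformations of the cluster. A matrix is irreducible if it cannot be brought, by a simultaneous permutation of rows and columns, to block upper triangular form with at least two diagonal blocks. List of seeds $\Omega_{3,i}=(B_{3,i},\mathbf x,R_{3,i},\mathbf Z_{3,i})$ (the cluster is arbitrary; matrices row by row; $R$ by its diagonal; $k,k_1,k_2,k_3$ arbitrary non-negative integers; $Z_j=1+u$ whenever $r_j=1$): $i=1$: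 $B=[0,2,-2;\,-2,0,2;\,2,-2,0]$, $R=(1,1,1)$. $i=2$: $B=[0,2,-1;\,-2,0,1;\,2,-2,0]$, $R=(1,1,2)$, $Z_3=1+k_3u+u^2$. $i=3$: $B=[0,2,-1;\,-1,0,1;\,1,-2,0]$, $R=(2,1,2)$, $Z_1=1+k_1u+u^2$, $Z_3=1+k_3u+u^2$. $i=4$: $B=[0,1,-1;\,-1,0,1;\,1,-1,0]$, $R=(2,2,2)$, $Z_j=1+k_ju+u^2$ for $j=1,2,3$. $i=5$: $B=[0,1,-1;\,-4,0,2;\,4,-2,0]$, $R=(1,1,1)$. $i=6$: $B=[0,1,-1;\,-2,0,2;\,2,-2,0]$, $R=(2,1,1)$, $Z_1=1+ku+u^2$. $i=7$: $B=[0,1,-1;\,-1,0,2;\,1,-2,0]$, $R=(4,1,1)$, $Z_1=1+k_1u+k_2u^2+k_1u^3+u^4$. $i=8$: $B=[0,4,-4;\,-1,0,2;\,1,-2,0]$, $R=(1,1,1)$. $i=9$: $B=[0,2,-4;\,-1,0,2;\,1,-1,0]$, $R=(1,2,1)$, $Z_2=1+k_2u+u^2$. $i=10$: $B=[0,2,-2;\,-1,0,1;\,1,-1,0]$, $R=(1,2,2)$, $Z_2=1+k_2u+u^2$, $Z_3=1+k_3u+u^2$.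
   Formalization: The formal conclusion also allows Ω = σ(−Ω_{3,i}), i.e. the listed seed with B replaced by −B; this adds only the case i = 9, since −Ω_{3,9} meets all hypotheses and has a nonconstant invariant but is not a permutation of any listed seed. *)

theory Defs
  imports
    "HOL-Analysis.Cartesian_Space"
    "HOL-Algebra.Bij"
    "HOL-Algebra.Generated_Groups"
    "HOL-Computational_Algebra.Fraction_Field"
    "HOL-Computational_Algebra.Polynomial"
    "HOL-Library.Poly_Mapping"
begin

text \<open>Indices range over the three-element type \<^typ>\<open>3\<close>, whose elements are 1, 2 and 3
  (with 3 = 0, so its order is not 1 < 2 < 3).\<close>

type_synonym ratfun3 = "rat poly poly poly fract"

text \<open>Polynomials and Laurent polynomials in three variables over the rationals are the monoid
  algebras of \<open>nat^3\<close> and \<open>int^3\<close>: a finitely supported map from exponent vectors to coefficients.\<close>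

type_synonym poly3 = "nat^3 \<Rightarrow>\<^sub>0 rat"
type_synonym laurent3 = "int^3 \<Rightarrow>\<^sub>0 rat"

definition eval_poly3 :: "poly3 \<Rightarrow> 'k::field_char_0^3 \<Rightarrow> 'k" where
  "eval_poly3 p y = (\<Sum>m\<in>Poly_Mapping.keys p.
     of_rat (Poly_Mapping.lookup p m) * (\<Prod>j\<in>UNIV. (y $ j) ^ (m $ j)))"

definition eval_laurent3 :: "laurent3 \<Rightarrow> 'k::field_char_0^3 \<Rightarrow> 'k" where
  "eval_laurent3 F y = (\<Sum>m\<in>Poly_Mapping.keys F.
     of_rat (Poly_Mapping.lookup F m) * (\<Prod>j\<in>UNIV. (y $ j) powi (m $ j)))"

definition free_generators :: "'k::field_char_0^3 \<Rightarrow> bool" where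
  "free_generators x \<longleftrightarrow>
     (\<forall>p. eval_poly3 p x = 0 \<longrightarrow> p = 0) \<and>
     (\<forall>f. \<exists>p q. eval_poly3 q x \<noteq> 0 \<and> f = eval_poly3 p x / eval_poly3 q x)"

definition skew_symmetrizable :: "int^3^3 \<Rightarrow> bool" where
  "skew_symmetrizable B \<longleftrightarrow>
     (\<exists>S. (\<forall>i j. i \<noteq> j \<longrightarrow> S $ i $ j = 0) \<and> (\<forall>i. S $ i $ i > 0) \<and>
          transpose (S ** B) = - (S ** B))"

definition permute_matrix :: "(3 \<Rightarrow> 3) \<Rightarrow> 'a^3^3 \<Rightarrow> 'a^3^3" where
  "permute_matrix \<sigma> A = (\<chi> i j. A $ \<sigma> i $ \<sigma> j)"

text \<open>\<open>\<beta> n\<close> is the number of the diagonal block to which the position \<open>n\<close> in 1, 2, 3 belongs.\<close>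

definition block_upper_triangular :: "(nat \<Rightarrow> nat) \<Rightarrow> 'a::zero^3^3 \<Rightarrow> bool" where
  "block_upper_triangular \<beta> A \<longleftrightarrow> mono_on {1..3} \<beta> \<and>
     (\<forall>m\<in>{1..3}. \<forall>n\<in>{1..3}. \<beta> n < \<beta> m \<longrightarrow> A $ of_nat m $ of_nat n = 0)"

definition irreducible_matrix :: "'a::zero^3^3 \<Rightarrow> bool" where
  "irreducible_matrix A \<longleftrightarrow>
     \<not> (\<exists>\<sigma> \<beta>. bij \<sigma> \<and> card (\<beta> ` {1..3}) \<ge> 2 \<and> block_upper_triangular \<beta> (permute_matrix \<sigma> A))"

text \<open>The diagonal matrix \<open>R\<close> is stored as the vector of its diagonal entries.\<close>

record 'k seed =
  exch :: "int^3^3"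
  cluster :: "'k^3"
  degs :: "nat^3"
  polys :: "(nat poly)^3"

definition is_seed :: "'k::field_char_0 seed \<Rightarrow> bool" where
  "is_seed \<Omega> \<longleftrightarrow>
     skew_symmetrizable (exch \<Omega>) \<and>
     free_generators (cluster \<Omega>) \<and>
     (\<forall>k. degs \<Omega> $ k > 0) \<and>
     (\<forall>k. degree (polys \<Omega> $ k) \<le> degs \<Omega> $ k \<and>
          (\<forall>i\<le>degs \<Omega> $ k.
             coeff (polys \<Omega> $ k) i = coeff (polys \<Omega> $ k) (degs \<Omega> $ k - i)) \<and>
          coeff (polys \<Omega> $ k) 0 = 1 \<and> coeff (polys \<Omega> $ k) (degs \<Omega> $ k) = 1)"

definition pos_part :: "int \<Rightarrow> int" where
  "pos_part a = max a 0"

definition exchange_poly :: "'k::field seed \<Rightarrow> 3 \<Rightarrow> 'k" where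
  "exchange_poly \<Omega> s = (\<Sum>i\<le>degs \<Omega> $ s. of_nat (coeff (polys \<Omega> $ s) i) *
     (\<Prod>j\<in>UNIV. (cluster \<Omega> $ j) powi
        (int i * pos_part (exch \<Omega> $ j $ s) + int (degs \<Omega> $ s - i) * pos_part (- (exch \<Omega> $ j $ s)))))"

definition mutate_matrix :: "nat^3 \<Rightarrow> 3 \<Rightarrow> int^3^3 \<Rightarrow> int^3^3" where
  "mutate_matrix R s B = (\<chi> i j.
     if i = s \<or> j = s then - (B $ i $ j)
     else B $ i $ j + int (R $ s) *
       (pos_part (B $ i $ s) * B $ s $ j + B $ i $ s * pos_part (- (B $ s $ j))))"

definition mutate :: "3 \<Rightarrow> 'k::field seed \<Rightarrow> 'k seed" where
  "mutate s \<Omega> = \<lparr>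
     exch = mutate_matrix (degs \<Omega>) s (exch \<Omega>),
     cluster = (\<chi> j. if j = s then exchange_poly \<Omega> s / cluster \<Omega> $ s else cluster \<Omega> $ j),
     degs = degs \<Omega>,
     polys = polys \<Omega>\<rparr>"

definition permute_seed :: "(3 \<Rightarrow> 3) \<Rightarrow> 'k seed \<Rightarrow> 'k seed" where
  "permute_seed \<sigma> \<Omega> = \<lparr>
     exch = permute_matrix \<sigma> (exch \<Omega>),
     cluster = (\<chi> i. cluster \<Omega> $ \<sigma> i),
     degs = (\<chi> i. degs \<Omega> $ \<sigma> i),
     polys = (\<chi> i. polys \<Omega> $ \<sigma> i)\<rparr>"

definition cluster_symmetries :: "'k::field seed \<Rightarrow> ('k seed \<Rightarrow> 'k seed) set" where
  "cluster_symmetries \<Omega> = {permute_seed \<sigma> \<circ> mutate s |\<sigma> s. bij \<sigma> \<and>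
     (\<exists>x'. permute_seed \<sigma> (mutate s \<Omega>) = \<Omega>\<lparr>cluster := x'\<rparr> \<or>
           permute_seed \<sigma> (mutate s \<Omega>) = \<Omega>\<lparr>exch := - exch \<Omega>, cluster := x'\<rparr>)}"

text \<open>The mutation in direction \<open>s\<close> regarded as a transformation of clusters, with the remaining
  data of the seed fixed. As the mutated seed has exchange matrix \<open>\<plusminus>B\<close> when the mutation is a
  cluster symmetry, and the exchange polynomials do not depend on this sign (because the
  \<open>Z\<^sub>k\<close> are palindromic), compositions of these maps agree with iterated mutations of seeds.\<close>

definition cluster_mutation :: "'k::field_char_0 seed \<Rightarrow> 3 \<Rightarrow> 'k^3 \<Rightarrow> 'k^3" where
  "cluster_mutation \<Omega> s =
     restrict (\<lambda>y. cluster (mutate s (\<Omega>\<lparr>cluster := y\<rparr>))) (Collect free_generators)"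

definition mutation_group :: "'k::field_char_0 seed \<Rightarrow> ('k^3 \<Rightarrow> 'k^3) set" where
  "mutation_group \<Omega> =
     generate (BijGroup (Collect free_generators)) {cluster_mutation \<Omega> s |s. s \<in> {1, 2, 3}}"

definition invariant_ring :: "'k::field_char_0 seed \<Rightarrow> laurent3 set" where
  "invariant_ring \<Omega> = {F. \<forall>g\<in>mutation_group \<Omega>.
     eval_laurent3 F (g (cluster \<Omega>)) = eval_laurent3 F (cluster \<Omega>)}"

definition constant_laurent3 :: "laurent3 set" where
  "constant_laurent3 = range (Poly_Mapping.single 0)"

text \<open>Negating the exchange matrix leaves the exchange polynomials, hence the invariant ring and the
  condition \<open>\<mu>\<^sub>s(B) = \<plusminus>B\<close>, unchanged. Below, the opposite of \<open>Omega3 i\<close> is a permutation of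
  \<open>Omega3 i\<close> (up to the choice of the parameters) except for \<open>i = 9\<close>, where it is not a permutation
  of any listed seed; a classification by this list is therefore a classification up to the sign
  of \<open>B\<close>.\<close>

definition opposite :: "'k seed \<Rightarrow> 'k seed" where
  "opposite \<Omega> = \<Omega>\<lparr>exch := - exch \<Omega>\<rparr>"

definition mat3 :: "int list \<Rightarrow> int list \<Rightarrow> int list \<Rightarrow> int^3^3" where
  "mat3 r1 r2 r3 = vector [vector r1, vector r2, vector r3]"

text \<open>For each \<open>i\<close>, \<open>Omega3 i\<close> is the family of seeds obtained by letting the cluster and the
  non-negative integer parameters vary.\<close>

inductive Omega3 :: "nat \<Rightarrow> 'k::field_char_0 seed \<Rightarrow> bool" where
  "free_generators x \<Longrightarrow> Omega3 1 \<lparr>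
     exch = mat3 [0, 2, -2] [-2, 0, 2] [2, -2, 0], cluster = x,
     degs = vector [1, 1, 1], polys = vector [[:1, 1:], [:1, 1:], [:1, 1:]]\<rparr>"
| "free_generators x \<Longrightarrow> Omega3 2 \<lparr>
     exch = mat3 [0, 2, -1] [-2, 0, 1] [2, -2, 0], cluster = x,
     degs = vector [1, 1, 2], polys = vector [[:1, 1:], [:1, 1:], [:1, k3, 1:]]\<rparr>"
| "free_generators x \<Longrightarrow> Omega3 3 \<lparr>
     exch = mat3 [0, 2, -1] [-1, 0, 1] [1, -2, 0], cluster = x,
     degs = vector [2, 1, 2], polys = vector [[:1, k1, 1:], [:1, 1:], [:1, k3, 1:]]\<rparr>"
| "free_generators x \<Longrightarrow> Omega3 4 \<lparr>
     exch = mat3 [0, 1, -1] [-1, 0, 1] [1, -1, 0], cluster = x,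
     degs = vector [2, 2, 2], polys = vector [[:1, k1, 1:], [:1, k2, 1:], [:1, k3, 1:]]\<rparr>"
| "free_generators x \<Longrightarrow> Omega3 5 \<lparr>
     exch = mat3 [0, 1, -1] [-4, 0, 2] [4, -2, 0], cluster = x,
     degs = vector [1, 1, 1], polys = vector [[:1, 1:], [:1, 1:], [:1, 1:]]\<rparr>"
| "free_generators x \<Longrightarrow> Omega3 6 \<lparr>
     exch = mat3 [0, 1, -1] [-2, 0, 2] [2, -2, 0], cluster = x,
     degs = vector [2, 1, 1], polys = vector [[:1, k, 1:], [:1, 1:], [:1, 1:]]\<rparr>"
| "free_generators x \<Longrightarrow> Omega3 7 \<lparr>
     exch = mat3 [0, 1, -1] [-1, 0, 2] [1, -2, 0], cluster = x,
     degs = vector [4, 1, 1], polys = vector [[:1, k1, k2, k1, 1:], [:1, 1:], [:1, 1:]]\<rparr>"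
| "free_generators x \<Longrightarrow> Omega3 8 \<lparr>
     exch = mat3 [0, 4, -4] [-1, 0, 2] [1, -2, 0], cluster = x,
     degs = vector [1, 1, 1], polys = vector [[:1, 1:], [:1, 1:], [:1, 1:]]\<rparr>"
| "free_generators x \<Longrightarrow> Omega3 9 \<lparr>
     exch = mat3 [0, 2, -4] [-1, 0, 2] [1, -1, 0], cluster = x,
     degs = vector [1, 2, 1], polys = vector [[:1, 1:], [:1, k2, 1:], [:1, 1:]]\<rparr>"
| "free_generators x \<Longrightarrow> Omega3 10 \<lparr>
     exch = mat3 [0, 2, -2] [-1, 0, 1] [1, -1, 0], cluster = x,
     degs = vector [1, 2, 2], polys = vector [[:1, 1:], [:1, k2, 1:], [:1, k3, 1:]]\<rparr>"

end

theory Submission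
  imports Defs
begin

text \<open>Irreducibility forces \<open>\<mu>\<^sub>s(B) = -B\<close> for every \<open>s\<close>, which amounts to
  \<open>r\<^sub>j b\<^sub>i\<^sub>j \<bar>b\<^sub>j\<^sub>k\<bar> = -2 b\<^sub>i\<^sub>k\<close> for distinct \<open>i, j, k\<close>, with all off-diagonal entries nonzero. Hence
  \<open>r\<^sub>i r\<^sub>j \<bar>b\<^sub>i\<^sub>j b\<^sub>j\<^sub>i\<bar> = 4\<close>, so that only finitely many pairs \<open>(B, R)\<close> remain, and up to cyclic rotation
  and sign they are exactly the listed ones. Thus both sides of the equivalence hold under the
  hypotheses, and it remains to give an invariant for each listed seed. For seven of these the powers
  \<open>u\<^sub>j = x\<^sub>j ^ n\<^sub>j\<close>, with suitable \<open>n\<^sub>j \<in> {1, 2}\<close>, turn the mutations into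
  \<open>u\<^sub>s u\<^sub>s' = u\<^sub>j\<^sup>2 + k\<^sub>s u\<^sub>j u\<^sub>k + u\<^sub>k\<^sup>2\<close>, which preserve the Markov-type quotient
  \<open>(u\<^sub>1\<^sup>2 + u\<^sub>2\<^sup>2 + u\<^sub>3\<^sup>2 + k\<^sub>1 u\<^sub>2 u\<^sub>3 + k\<^sub>2 u\<^sub>1 u\<^sub>3 + k\<^sub>3 u\<^sub>1 u\<^sub>2) / (u\<^sub>1 u\<^sub>2 u\<^sub>3)\<close>; the seeds 2, 7 and 8
  reduce in the same way to a second family, with one quartic exchange polynomial.\<close>

section \<open>Evaluation of polynomials and Laurent polynomials\<close>

text \<open>The linear extension of \<open>h\<close> to the monoid algebra. Polynomials and Laurent
  polynomials are the two instances in which \<open>h\<close> evaluates monomials, so the ring laws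
  are proved once for both.\<close>

definition eval_mapping :: "('a::monoid_add \<Rightarrow> 'k::field_char_0) \<Rightarrow> ('a \<Rightarrow>\<^sub>0 rat) \<Rightarrow> 'k" where
  "eval_mapping h p = (\<Sum>m\<in>Poly_Mapping.keys p. of_rat (Poly_Mapping.lookup p m) * h m)"

lemma eval_mapping_superset:
  assumes "finite A" "Poly_Mapping.keys p \<subseteq> A"
  shows "eval_mapping h p = (\<Sum>m\<in>A. of_rat (Poly_Mapping.lookup p m) * h m)"
  unfolding eval_mapping_def
  by (rule sum.mono_neutral_left) (use assms in \<open>auto simp: in_keys_iff\<close>)

lemma eval_mapping_zero [simp]: "eval_mapping h 0 = 0"
  by (simp add: eval_mapping_def)

lemma eval_mapping_single: "eval_mapping h (Poly_Mapping.single m c) = of_rat c * h m"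
  by (subst eval_mapping_superset[where A = "{m}"]) auto

lemma eval_mapping_add: "eval_mapping h (p + q) = eval_mapping h p + eval_mapping h q"
proof -
  let ?A = "Poly_Mapping.keys p \<union> Poly_Mapping.keys q"
  show ?thesis
    using Poly_Mapping.keys_add[of p q]
    by (simp add: eval_mapping_superset[where A = ?A] lookup_add of_rat_add
        distrib_right sum.distrib)
qed

lemma eval_mapping_sum: "eval_mapping h (sum f I) = (\<Sum>i\<in>I. eval_mapping h (f i))"
  by (induction I rule: infinite_finite_induct) (auto simp: eval_mapping_add)

lemma sum_single_lookup:
  fixes p :: "'a \<Rightarrow>\<^sub>0 'b::comm_monoid_add"
  shows "(\<Sum>m\<in>Poly_Mapping.keys p. Poly_Mapping.single m (Poly_Mapping.lookup p m)) = p"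
  by (rule poly_mapping_eqI)
    (simp add: lookup_sum lookup_single when_def in_keys_iff)

lemma eval_mapping_mult:
  assumes "\<And>a b. h (a + b) = h a * h b"
  shows "eval_mapping h (p * q) = eval_mapping h p * eval_mapping h q"
proof -
  have "p * q = (\<Sum>m\<in>Poly_Mapping.keys p. \<Sum>n\<in>Poly_Mapping.keys q.
      Poly_Mapping.single (m + n) (Poly_Mapping.lookup p m * Poly_Mapping.lookup q n))"
    by (subst (1 2) sum_single_lookup[symmetric]) (simp only: sum_product mult_single)
  then show ?thesis
    by (simp add: eval_mapping_sum eval_mapping_single assms eval_mapping_def[of h p]
        eval_mapping_def[of h q] sum_product of_rat_mult mult_ac)
qed

lemma eval_poly3_mapping: "eval_poly3 p y = eval_mapping (\<lambda>m. \<Prod>j\<in>UNIV. (y $ j) ^ (m $ j)) p"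
  by (simp add: eval_poly3_def eval_mapping_def)

lemma eval_laurent3_mapping:
  "eval_laurent3 F y = eval_mapping (\<lambda>m. \<Prod>j\<in>UNIV. (y $ j) powi (m $ j)) F"
  by (simp add: eval_laurent3_def eval_mapping_def)

lemma eval_poly3_mult: "eval_poly3 (p * q) y = eval_poly3 p y * eval_poly3 q y"
  unfolding eval_poly3_mapping
  by (rule eval_mapping_mult) (simp add: power_add prod.distrib)

text \<open>Integer powers of a nonzero element are additive in the exponent; at 0 this fails, as 0
  powi 1 * 0 powi (-1) = 0 while 0 powi 0 = 1.\<close>

lemma eval_laurent3_mult:
  assumes "\<forall>j. y $ j \<noteq> 0"
  shows "eval_laurent3 (F * G) y = eval_laurent3 F y * eval_laurent3 G y"
  unfolding eval_laurent3_mapping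
  by (rule eval_mapping_mult) (use assms in \<open>simp add: power_int_add prod.distrib\<close>)

section \<open>Polynomial and Laurent polynomial functions\<close>

definition poly_fun :: "('k::field_char_0^3 \<Rightarrow> 'k) \<Rightarrow> bool" where
  "poly_fun f \<longleftrightarrow> (\<exists>p. \<forall>y. eval_poly3 p y = f y)"

text \<open>Agreement is demanded only where all coordinates are nonzero: there
  \<open>eval_laurent3\<close> is multiplicative, so closure rules can replace explicit coefficient
  maps.\<close>

definition laurent_fun :: "('k::field_char_0^3 \<Rightarrow> 'k) \<Rightarrow> bool" where
  "laurent_fun f \<longleftrightarrow> (\<exists>F. \<forall>y. (\<forall>j. y $ j \<noteq> 0) \<longrightarrow> eval_laurent3 F y = f y)"

lemma poly_fun_eval: "poly_fun (eval_poly3 p)"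
  by (auto simp: poly_fun_def)

lemma poly_fun_of_rat: "poly_fun (\<lambda>y. of_rat c)"
  unfolding poly_fun_def
  by (rule exI[of _ "Poly_Mapping.single 0 c"]) (simp add: eval_poly3_mapping eval_mapping_single)

lemma poly_fun_coord: "poly_fun (\<lambda>y. y $ j)"
proof -
  have "eval_poly3 (Poly_Mapping.single (\<chi> i. if i = j then 1 else 0) 1) y = y $ j" for y :: "'a^3"
  proof -
    have "(\<Prod>i\<in>UNIV. y $ i ^ (if i = j then 1 else 0)) = (\<Prod>i\<in>UNIV. if i = j then y $ i else 1)"
      by (rule prod.cong) auto
    then show ?thesis
      by (simp add: eval_poly3_mapping eval_mapping_single)
  qed
  then show ?thesis
    unfolding poly_fun_def by blast
qed

lemma poly_fun_add: "poly_fun f \<Longrightarrow> poly_fun g \<Longrightarrow> poly_fun (\<lambda>y. f y + g y)"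
  unfolding poly_fun_def
proof (elim exE)
  fix p q assume "\<forall>y. eval_poly3 p y = f y" "\<forall>y. eval_poly3 q y = g y"
  then have "\<forall>y. eval_poly3 (p + q) y = f y + g y"
    by (simp add: eval_poly3_mapping eval_mapping_add)
  then show "\<exists>p. \<forall>y. eval_poly3 p y = f y + g y" by blast
qed

lemma poly_fun_mult: "poly_fun f \<Longrightarrow> poly_fun g \<Longrightarrow> poly_fun (\<lambda>y. f y * g y)"
  unfolding poly_fun_def
proof (elim exE)
  fix p q assume "\<forall>y. eval_poly3 p y = f y" "\<forall>y. eval_poly3 q y = g y"
  then have "\<forall>y. eval_poly3 (p * q) y = f y * g y"
    by (simp add: eval_poly3_mult)
  then show "\<exists>p. \<forall>y. eval_poly3 p y = f y * g y" by blast
qed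

lemma poly_fun_of_nat: "poly_fun (\<lambda>y. of_nat n)"
  using poly_fun_of_rat[of "of_nat n"] by simp

lemma poly_fun_sum: "(\<And>i. i \<in> I \<Longrightarrow> poly_fun (f i)) \<Longrightarrow> poly_fun (\<lambda>y. \<Sum>i\<in>I. f i y)"
  using poly_fun_of_nat[of 0]
  by (induction I rule: infinite_finite_induct) (auto intro: poly_fun_add)

lemma poly_fun_prod: "(\<And>i. i \<in> I \<Longrightarrow> poly_fun (f i)) \<Longrightarrow> poly_fun (\<lambda>y. \<Prod>i\<in>I. f i y)"
  using poly_fun_of_nat[of 1]
  by (induction I rule: infinite_finite_induct) (auto intro: poly_fun_mult)

lemma poly_fun_power: "poly_fun f \<Longrightarrow> poly_fun (\<lambda>y. f y ^ n)"
  using poly_fun_of_nat[of 1] by (induction n) (auto intro: poly_fun_mult)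

text \<open>The sum defining \<open>eval_poly3\<close> is itself built by the closure rules, and a
  permuted coordinate is still a coordinate.\<close>

lemma poly_fun_permute:
  assumes "poly_fun f"
  shows "poly_fun (\<lambda>y. f (\<chi> i. y $ \<sigma> i))"
proof -
  from assms obtain p where "\<forall>y. eval_poly3 p y = f y"
    unfolding poly_fun_def by blast
  then have "f = eval_poly3 p"
    by (simp add: fun_eq_iff)
  then show ?thesis
    unfolding eval_poly3_def
    by (auto intro!: poly_fun_sum poly_fun_mult poly_fun_of_rat poly_fun_prod poly_fun_power
        poly_fun_coord)
qed

lemma laurent_fun_of_rat: "laurent_fun (\<lambda>y. of_rat c)"
  unfolding laurent_fun_def
  by (rule exI[of _ "Poly_Mapping.single 0 c"])
    (simp add: eval_laurent3_mapping eval_mapping_single)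

lemma laurent_fun_coord_powi: "laurent_fun (\<lambda>y. y $ j powi n)"
proof -
  have "eval_laurent3 (Poly_Mapping.single (\<chi> i. if i = j then n else 0) 1) y = y $ j powi n"
    for y :: "'a^3"
  proof -
    have "(\<Prod>i\<in>UNIV. y $ i powi (if i = j then n else 0)) =
        (\<Prod>i\<in>UNIV. if i = j then y $ i powi n else 1)"
      by (rule prod.cong) auto
    then show ?thesis
      by (simp add: eval_laurent3_mapping eval_mapping_single)
  qed
  then show ?thesis
    unfolding laurent_fun_def by blast
qed

lemma laurent_fun_coord: "laurent_fun (\<lambda>y. y $ j)"
  using laurent_fun_coord_powi[of j 1] by simp

lemma laurent_fun_add: "laurent_fun f \<Longrightarrow> laurent_fun g \<Longrightarrow> laurent_fun (\<lambda>y. f y + g y)"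
  unfolding laurent_fun_def
proof (elim exE)
  fix F G
  assume "\<forall>y. (\<forall>j. y $ j \<noteq> 0) \<longrightarrow> eval_laurent3 F y = f y"
    "\<forall>y. (\<forall>j. y $ j \<noteq> 0) \<longrightarrow> eval_laurent3 G y = g y"
  then have "\<forall>y. (\<forall>j. y $ j \<noteq> 0) \<longrightarrow> eval_laurent3 (F + G) y = f y + g y"
    by (simp add: eval_laurent3_mapping eval_mapping_add)
  then show "\<exists>F. \<forall>y. (\<forall>j. y $ j \<noteq> 0) \<longrightarrow> eval_laurent3 F y = f y + g y"
    by blast
qed

lemma laurent_fun_mult: "laurent_fun f \<Longrightarrow> laurent_fun g \<Longrightarrow> laurent_fun (\<lambda>y. f y * g y)"
  unfolding laurent_fun_def
proof (elim exE)
  fix F G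
  assume "\<forall>y. (\<forall>j. y $ j \<noteq> 0) \<longrightarrow> eval_laurent3 F y = f y"
    "\<forall>y. (\<forall>j. y $ j \<noteq> 0) \<longrightarrow> eval_laurent3 G y = g y"
  then have "\<forall>y. (\<forall>j. y $ j \<noteq> 0) \<longrightarrow> eval_laurent3 (F * G) y = f y * g y"
    by (simp add: eval_laurent3_mult)
  then show "\<exists>F. \<forall>y. (\<forall>j. y $ j \<noteq> 0) \<longrightarrow> eval_laurent3 F y = f y * g y"
    by blast
qed

lemma laurent_fun_of_nat: "laurent_fun (\<lambda>y. of_nat n)"
  using laurent_fun_of_rat[of "of_nat n"] by simp

lemma laurent_fun_numeral: "laurent_fun (\<lambda>y. numeral n)"
  using laurent_fun_of_nat[of "numeral n"] by simp

lemma laurent_fun_diff: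
  assumes "laurent_fun f" "laurent_fun g" shows "laurent_fun (\<lambda>y. f y - g y)"
  using laurent_fun_add[OF assms(1) laurent_fun_mult[OF laurent_fun_of_rat[of "-1"] assms(2)]]
  by simp

lemma laurent_fun_sum: "(\<And>i. i \<in> I \<Longrightarrow> laurent_fun (f i)) \<Longrightarrow> laurent_fun (\<lambda>y. \<Sum>i\<in>I. f i y)"
  using laurent_fun_of_nat[of 0]
  by (induction I rule: infinite_finite_induct) (auto intro: laurent_fun_add)

lemma laurent_fun_prod: "(\<And>i. i \<in> I \<Longrightarrow> laurent_fun (f i)) \<Longrightarrow> laurent_fun (\<lambda>y. \<Prod>i\<in>I. f i y)"
  using laurent_fun_of_nat[of 1]
  by (induction I rule: infinite_finite_induct) (auto intro: laurent_fun_mult)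

lemma laurent_fun_power: "laurent_fun f \<Longrightarrow> laurent_fun (\<lambda>y. f y ^ n)"
  using laurent_fun_of_nat[of 1] by (induction n) (auto intro: laurent_fun_mult)

lemma laurent_fun_divide: "laurent_fun f \<Longrightarrow> laurent_fun (\<lambda>y. f y / y $ j)"
  using laurent_fun_mult[of f, OF _ laurent_fun_coord_powi[of j "-1"]]
  by (simp add: power_int_minus field_simps)

lemma laurent_fun_divide_power: "laurent_fun f \<Longrightarrow> laurent_fun (\<lambda>y. f y / (y $ j) ^ n)"
proof (induction n)
  case (Suc n)
  have "laurent_fun (\<lambda>y. f y / (y $ j) ^ n / y $ j)"
    by (rule laurent_fun_divide) (rule Suc.IH, rule Suc.prems)
  then show ?case by (simp add: mult.commute)
qed simp

lemmas laurent_fun_intros = laurent_fun_numeral laurent_fun_of_nat laurent_fun_coord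
  laurent_fun_add laurent_fun_diff laurent_fun_mult laurent_fun_power
  laurent_fun_divide laurent_fun_divide_power

lemma laurent_fun_permute:
  fixes f :: "'k::field_char_0^3 \<Rightarrow> 'k"
  assumes "laurent_fun f"
  shows "laurent_fun (\<lambda>y. f (\<chi> i. y $ \<sigma> i))"
proof -
  from assms obtain F where F: "\<And>y. \<forall>j. y $ j \<noteq> 0 \<Longrightarrow> eval_laurent3 F y = f y"
    unfolding laurent_fun_def by blast
  have "laurent_fun (\<lambda>y. eval_laurent3 F (\<chi> i. y $ \<sigma> i) :: 'k)"
    unfolding eval_laurent3_def
    by (auto intro!: laurent_fun_sum laurent_fun_mult laurent_fun_of_rat laurent_fun_prod
        laurent_fun_coord_powi)
  then show ?thesis
    unfolding laurent_fun_def by (simp add: F[symmetric])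
qed

section \<open>Free generators\<close>

lemma free_generators_nonzero:
  assumes "free_generators x"
  shows "x $ j \<noteq> 0"
proof
  assume "x $ j = 0"
  obtain p where p: "\<And>y::'a^3. eval_poly3 p y = y $ j"
    using poly_fun_coord[of j] unfolding poly_fun_def by blast
  with \<open>x $ j = 0\<close> assms have "p = 0"
    by (auto simp: free_generators_def)
  \<comment> \<open>The coordinate polynomial takes the value 1 at the all-ones point, the zero
    polynomial the value 0.\<close>
  with p[of "\<chi> i. 1"] show False
    by (simp add: eval_poly3_mapping)
qed

text \<open>Algebraic independence: a polynomial vanishing at \<open>x\<close> is the zero
  polynomial, so a relation at free generators is an identity.\<close>

lemma free_generators_relation:
  assumes "free_generators x" "poly_fun f" "f x = 0"
  shows "f y = 0"
proof -
  obtain p where p: "\<And>y. eval_poly3 p y = f y"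
    using assms(2) unfolding poly_fun_def by blast
  with assms have "p = 0"
    by (auto simp: free_generators_def)
  with p[of y] show ?thesis
    by (simp add: eval_poly3_mapping)
qed

text \<open>The relations valid at free generators hold at every point, in particular at the point that
  the transformation \<open>\<tau>\<close> sends back to the given generators.\<close>

lemma free_generators_transform:
  fixes x :: "'k::field_char_0^3"
  assumes x: "free_generators x"
    and d: "poly_fun d" "d x \<noteq> 0" "d z \<noteq> 0"
    and num: "\<And>p. \<exists>n g. poly_fun g \<and> (\<forall>y. d y \<noteq> 0 \<longrightarrow> g y = d y ^ n * eval_poly3 p (\<tau> y))"
    and z: "z = \<tau> x" "\<tau> z = x"
  shows "free_generators z"
  unfolding free_generators_def
proof (intro conjI allI impI)
  fix p assume p: "eval_poly3 p z = 0"
  obtain n g where g: "poly_fun g" "\<And>y. d y \<noteq> 0 \<Longrightarrow> g y = d y ^ n * eval_poly3 p (\<tau> y)"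
    using num[of p] by blast
  have "g x = 0"
    using g(2)[OF d(2)] z p by simp
  then have "g z = 0"
    using free_generators_relation[OF x g(1)] by simp
  then have "eval_poly3 p x = 0"
    using g(2)[OF d(3)] z d by simp
  then show "p = 0"
    using x by (simp add: free_generators_def)
next
  fix f :: 'k
  obtain p q where pq: "eval_poly3 q x \<noteq> 0" "f = eval_poly3 p x / eval_poly3 q x"
    using x unfolding free_generators_def by blast
  obtain m g where g: "poly_fun g" "\<And>y. d y \<noteq> 0 \<Longrightarrow> g y = d y ^ m * eval_poly3 p (\<tau> y)"
    using num[of p] by blast
  obtain n h where h: "poly_fun h" "\<And>y. d y \<noteq> 0 \<Longrightarrow> h y = d y ^ n * eval_poly3 q (\<tau> y)"
    using num[of q] by blast
  \<comment> \<open>Each side receives the other's power of \<open>d\<close>, so numerator and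
    denominator at \<open>z\<close> acquire the same factor d z ^ (m + n), which cancels.\<close>
  obtain p' where p': "\<And>y. eval_poly3 p' y = g y * d y ^ n"
    using poly_fun_mult[OF g(1) poly_fun_power[OF d(1), of n]] unfolding poly_fun_def by blast
  obtain q' where q': "\<And>y. eval_poly3 q' y = h y * d y ^ m"
    using poly_fun_mult[OF h(1) poly_fun_power[OF d(1), of m]] unfolding poly_fun_def by blast
  show "\<exists>p q. eval_poly3 q z \<noteq> 0 \<and> f = eval_poly3 p z / eval_poly3 q z"
    using d(3) pq by (intro exI[of _ p'] exI[of _ q']) (simp add: p' q' g(2) h(2) z(2))
qed

lemma free_generators_permute:
  fixes x :: "'k::field_char_0^3"
  assumes "free_generators x" "bij \<sigma>"
  shows "free_generators (\<chi> i. x $ \<sigma> i)"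
proof -
  obtain \<tau> where \<tau>: "\<And>i. \<sigma> (\<tau> i) = i" "\<And>i. \<tau> (\<sigma> i) = i"
    using assms(2) by (metis bij_pointE)
  have "free_generators z" if "z = (\<chi> i. x $ \<sigma> i)" for z
  proof -
    have num: "poly_fun (\<lambda>y::'k^3. eval_poly3 p (\<chi> i. y $ \<sigma> i))" for p
      by (rule poly_fun_permute) (rule poly_fun_eval)
    have num': "poly_fun (\<lambda>y::'k^3. eval_poly3 p (\<chi> i. y $ \<tau> i))" for p
      by (rule poly_fun_permute) (rule poly_fun_eval)
    have x: "(\<chi> i. z $ \<tau> i) = x"
      by (simp add: that vec_eq_iff \<tau>)
    show ?thesis
      unfolding free_generators_def
    proof (intro conjI allI impI)
      fix p assume "eval_poly3 p z = 0"
      then have "eval_poly3 p (\<chi> i. (\<chi> i. x $ \<tau> i) $ \<sigma> i) = 0"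
        using free_generators_relation[OF assms(1) num[of p]] that by blast
      then have "eval_poly3 p x = 0"
        by (simp add: \<tau>)
      then show "p = 0"
        using assms(1) by (simp add: free_generators_def)
    next
      fix f :: 'k
      obtain p q where pq: "eval_poly3 q x \<noteq> 0" "f = eval_poly3 p x / eval_poly3 q x"
        using assms(1) unfolding free_generators_def by blast
      obtain p' where p': "\<And>y::'k^3. eval_poly3 p' y = eval_poly3 p (\<chi> i. y $ \<tau> i)"
        using num'[of p] unfolding poly_fun_def by blast
      obtain q' where q': "\<And>y::'k^3. eval_poly3 q' y = eval_poly3 q (\<chi> i. y $ \<tau> i)"
        using num'[of q] unfolding poly_fun_def by blast
      show "\<exists>p q. eval_poly3 q z \<noteq> 0 \<and> f = eval_poly3 p z / eval_poly3 q z"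
        by (rule exI[of _ p'], rule exI[of _ q']) (simp add: p' q' x pq)
    qed
  qed
  then show ?thesis by simp
qed

section \<open>Mutations of clusters\<close>

lemma cluster_mutate:
  "cluster (mutate s (\<Omega>\<lparr>cluster := y\<rparr>)) =
     (\<chi> j. if j = s then exchange_poly (\<Omega>\<lparr>cluster := y\<rparr>) s / y $ s else y $ j)"
  by (simp add: mutate_def vec_eq_iff)

text \<open>The zero diagonal entry gives the coordinate \<open>s\<close> the exponent 0, so the
  exchange polynomial survives its own mutation. This makes mutations involutive.\<close>

lemma exchange_poly_cong:
  assumes "exch \<Omega> $ s $ s = 0" "\<And>j. j \<noteq> s \<Longrightarrow> y $ j = z $ j"
  shows "exchange_poly (\<Omega>\<lparr>cluster := y\<rparr>) s = exchange_poly (\<Omega>\<lparr>cluster := z\<rparr>) s"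
  unfolding exchange_poly_def
proof (intro sum.cong refl arg_cong2[where f = "(*)"] prod.cong)
  fix i and j :: 3
  show "(cluster (\<Omega>\<lparr>cluster := y\<rparr>) $ j) powi
      (int i * pos_part (exch (\<Omega>\<lparr>cluster := y\<rparr>) $ j $ s) +
        int (degs (\<Omega>\<lparr>cluster := y\<rparr>) $ s - i) * pos_part (- exch (\<Omega>\<lparr>cluster := y\<rparr>) $ j $ s)) =
    (cluster (\<Omega>\<lparr>cluster := z\<rparr>) $ j) powi
      (int i * pos_part (exch (\<Omega>\<lparr>cluster := z\<rparr>) $ j $ s) +
        int (degs (\<Omega>\<lparr>cluster := z\<rparr>) $ s - i) * pos_part (- exch (\<Omega>\<lparr>cluster := z\<rparr>) $ j $ s))"
    using assms by (cases "j = s") (simp_all add: pos_part_def)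
qed simp_all

lemma poly_fun_powi:
  assumes "0 \<le> n"
  shows "poly_fun (\<lambda>y. y $ j powi n)"
proof -
  have "poly_fun (\<lambda>y. (y $ j) ^ nat n)"
    by (rule poly_fun_power) (rule poly_fun_coord)
  then show ?thesis
    using assms by (simp add: power_int_def)
qed

lemma poly_fun_exchange_poly: "poly_fun (\<lambda>y. exchange_poly (\<Omega>\<lparr>cluster := y\<rparr>) s)"
  unfolding exchange_poly_def
  by (auto intro!: poly_fun_sum poly_fun_mult poly_fun_of_nat poly_fun_prod poly_fun_powi
      simp: pos_part_def)

text \<open>At the all-ones point the value is the sum of the coefficients, a natural number that is
  at least 1, hence nonzero in characteristic 0.\<close>

lemma exchange_poly_nonzero:
  fixes y :: "'k::field_char_0^3"
  assumes "free_generators y" "coeff (polys \<Omega> $ s) 0 = 1"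
  shows "exchange_poly (\<Omega>\<lparr>cluster := y\<rparr>) s \<noteq> 0"
proof
  assume "exchange_poly (\<Omega>\<lparr>cluster := y\<rparr>) s = 0"
  then have "exchange_poly (\<Omega>\<lparr>cluster := (\<chi> j. 1)\<rparr>) s = 0"
    using free_generators_relation[OF assms(1) poly_fun_exchange_poly] by blast
  then have "of_nat (\<Sum>i\<le>degs \<Omega> $ s. coeff (polys \<Omega> $ s) i) = (0::'k)"
    by (simp add: exchange_poly_def)
  then have "(\<Sum>i\<le>degs \<Omega> $ s. coeff (polys \<Omega> $ s) i) = 0"
    using of_nat_eq_0_iff by blast
  then show False
    using assms(2) by auto
qed

lemma cluster_mutate_clear_denominator:
  fixes p :: poly3 and \<Omega> :: "'k::field_char_0 seed"
  shows "\<exists>n g. poly_fun g \<and> (\<forall>y. y $ s \<noteq> 0 \<longrightarrow>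
      g y = (y $ s) ^ n * eval_poly3 p (cluster (mutate s (\<Omega>\<lparr>cluster := y\<rparr>))))"
proof -
  let ?K = "Poly_Mapping.keys p" and ?P = "\<lambda>y. exchange_poly (\<Omega>\<lparr>cluster := y\<rparr>) s"
  \<comment> \<open>An upper bound for all exponents of the coordinate \<open>s\<close>, the only
    one that acquires a denominator; the sum also covers the zero polynomial.\<close>
  define n where "n = (\<Sum>m\<in>?K. m $ s)"
  define g where "g = (\<lambda>y. \<Sum>m\<in>?K. of_rat (Poly_Mapping.lookup p m) *
      ((y $ s) ^ (n - m $ s) * ?P y ^ (m $ s) * (\<Prod>j\<in>UNIV - {s}. (y $ j) ^ (m $ j))))"
  have "poly_fun g"
    unfolding g_def
    by (intro poly_fun_sum poly_fun_mult poly_fun_of_rat poly_fun_power poly_fun_prod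
        poly_fun_coord poly_fun_exchange_poly)
  moreover have "g y = (y $ s) ^ n * eval_poly3 p (cluster (mutate s (\<Omega>\<lparr>cluster := y\<rparr>)))"
    if y: "y $ s \<noteq> 0" for y
    unfolding g_def eval_poly3_def sum_distrib_left
  proof (rule sum.cong, simp)
    fix m assume "m \<in> ?K"
    then have "m $ s \<le> n"
      unfolding n_def by (intro member_le_sum) auto
    then have "(y $ s) ^ n = (y $ s) ^ (n - m $ s) * (y $ s) ^ (m $ s)"
      by (simp flip: power_add)
    then show "of_rat (Poly_Mapping.lookup p m) *
        ((y $ s) ^ (n - m $ s) * ?P y ^ (m $ s) * (\<Prod>j\<in>UNIV - {s}. (y $ j) ^ (m $ j))) =
      (y $ s) ^ n * (of_rat (Poly_Mapping.lookup p m) *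
        (\<Prod>j\<in>UNIV. (cluster (mutate s (\<Omega>\<lparr>cluster := y\<rparr>)) $ j) ^ (m $ j)))"
      using y by (simp add: cluster_mutate prod.remove[where x = s] power_divide)
  qed
  ultimately show ?thesis by blast
qed

lemma mutate_involutive:
  assumes "exch \<Omega> $ s $ s = 0" "y $ s \<noteq> 0" "exchange_poly (\<Omega>\<lparr>cluster := y\<rparr>) s \<noteq> 0"
  shows "cluster (mutate s (\<Omega>\<lparr>cluster := cluster (mutate s (\<Omega>\<lparr>cluster := y\<rparr>))\<rparr>)) = y"
proof -
  have "exchange_poly (\<Omega>\<lparr>cluster := cluster (mutate s (\<Omega>\<lparr>cluster := y\<rparr>))\<rparr>) s =
      exchange_poly (\<Omega>\<lparr>cluster := y\<rparr>) s"
    by (rule exchange_poly_cong[OF assms(1)]) (simp add: cluster_mutate)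
  then show ?thesis
    using assms(2,3) by (subst cluster_mutate) (simp add: cluster_mutate vec_eq_iff)
qed

text \<open>Mutation is its own inverse and its only denominator is the coordinate \<open>s\<close>,
  so \<open>free_generators_transform\<close> applies with that coordinate as
  \<open>d\<close>.\<close>

lemma free_generators_mutate:
  assumes "exch \<Omega> $ s $ s = 0" "coeff (polys \<Omega> $ s) 0 = 1" "free_generators y"
  shows "free_generators (cluster (mutate s (\<Omega>\<lparr>cluster := y\<rparr>)))"
proof (rule free_generators_transform[OF assms(3), where d = "\<lambda>y. y $ s"])
  show "\<exists>n g. poly_fun g \<and> (\<forall>y. y $ s \<noteq> 0 \<longrightarrow>
      g y = (y $ s) ^ n * eval_poly3 p (cluster (mutate s (\<Omega>\<lparr>cluster := y\<rparr>))))" for p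
    by (rule cluster_mutate_clear_denominator)
  show "cluster (mutate s (\<Omega>\<lparr>cluster := cluster (mutate s (\<Omega>\<lparr>cluster := y\<rparr>))\<rparr>)) = y"
    using assms by (intro mutate_involutive free_generators_nonzero exchange_poly_nonzero)
  show "cluster (mutate s (\<Omega>\<lparr>cluster := y\<rparr>)) $ s \<noteq> 0"
    using assms by (simp add: cluster_mutate free_generators_nonzero exchange_poly_nonzero)
qed (use assms in \<open>simp_all add: poly_fun_coord free_generators_nonzero\<close>)

section \<open>The group generated by the mutations\<close>

lemma cluster_mutation_Bij:
  assumes "exch \<Omega> $ s $ s = 0" "coeff (polys \<Omega> $ s) 0 = 1"
  shows "cluster_mutation \<Omega> s \<in> Bij (Collect free_generators)"
    and "y \<in> Collect free_generators \<Longrightarrow> cluster_mutation \<Omega> s (cluster_mutation \<Omega> s y) = y"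
proof -
  have free: "cluster_mutation \<Omega> s y \<in> Collect free_generators"
    if "y \<in> Collect free_generators" for y
    using that assms by (simp add: cluster_mutation_def free_generators_mutate)
  show invol: "cluster_mutation \<Omega> s (cluster_mutation \<Omega> s y) = y"
    if "y \<in> Collect free_generators" for y
    using that free[OF that] assms
    by (simp add: cluster_mutation_def mutate_involutive free_generators_nonzero
        exchange_poly_nonzero)
  show "cluster_mutation \<Omega> s \<in> Bij (Collect free_generators)"
    unfolding Bij_def
    using free invol
    by (auto simp: cluster_mutation_def intro!: bij_betw_byWitness[where f' = "cluster_mutation \<Omega> s"])
qed

lemma inv_BijGroup_involution:
  assumes "f \<in> Bij S" "\<And>y. y \<in> S \<Longrightarrow> f (f y) = y"
  shows "inv\<^bsub>BijGroup S\<^esub> f = f"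
proof (rule group.inv_equality[OF group_BijGroup])
  show "f \<otimes>\<^bsub>BijGroup S\<^esub> f = \<one>\<^bsub>BijGroup S\<^esub>"
    using assms by (auto simp: BijGroup_def compose_def)
qed (use assms(1) in \<open>simp_all add: BijGroup_def\<close>)

text \<open>Inverses of generators are the generators themselves. Membership in \<open>Bij S\<close>
  is carried through the induction so that, in a composite, invariance under the left factor can be
  used at \<open>g y\<close>.\<close>

lemma generate_BijGroup_invariant:
  assumes "g \<in> generate (BijGroup S) H" "H \<subseteq> Bij S"
    and "\<And>f y. f \<in> H \<Longrightarrow> y \<in> S \<Longrightarrow> f (f y) = y"
    and "\<And>f y. f \<in> H \<Longrightarrow> y \<in> S \<Longrightarrow> h (f y) = h y"
  shows "g \<in> Bij S \<and> (\<forall>y\<in>S. h (g y) = h y)"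
  using assms(1)
proof induction
  case one
  then show ?case using id_Bij[of S] by (simp add: BijGroup_def restrict_def)
next
  case (incl f)
  then show ?case using assms by auto
next
  case (inv f)
  then show ?case using assms inv_BijGroup_involution[of f S] by auto
next
  case (eng f g)
  then have "y \<in> S \<Longrightarrow> g y \<in> S" for y
    using Bij_imp_funcset[of g S] by auto
  with eng show ?case
    by (simp add: BijGroup_def compose_Bij) (simp add: compose_def)
qed

section \<open>Seeds with a nonconstant invariant\<close>

text \<open>Invariance is asked at every point with nonzero coordinates whose mutation again has
  nonzero coordinates. This is independent of the cluster of the seed and can be checked by plain
  field arithmetic.\<close>

definition has_invariant :: "'k::field_char_0 seed \<Rightarrow> bool" where
  "has_invariant \<Omega> \<longleftrightarrow> (\<exists>f. laurent_fun f \<and>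
     (\<exists>y z. (\<forall>j. y $ j \<noteq> 0) \<and> (\<forall>j. z $ j \<noteq> 0) \<and> f y \<noteq> f z) \<and>
     (\<forall>s y. (\<forall>j. y $ j \<noteq> 0) \<longrightarrow> exchange_poly (\<Omega>\<lparr>cluster := y\<rparr>) s \<noteq> 0 \<longrightarrow>
        f (cluster (mutate s (\<Omega>\<lparr>cluster := y\<rparr>))) = f y))"

text \<open>Group elements permute the tuples of free generators and preserve \<open>f\<close>
  there, so the Laurent polynomial representing \<open>f\<close> is invariant; it is not constant
  because it separates two points.\<close>

lemma invariant_ring_nonconstant:
  fixes \<Omega> :: "'k::field_char_0 seed"
  assumes "has_invariant \<Omega>" "free_generators (cluster \<Omega>)"
    and "\<And>s. exch \<Omega> $ s $ s = 0" "\<And>s. coeff (polys \<Omega> $ s) 0 = 1"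
  shows "invariant_ring \<Omega> \<noteq> constant_laurent3"
proof -
  obtain f y z where f: "laurent_fun f" "\<forall>j. y $ j \<noteq> 0" "\<forall>j. z $ j \<noteq> 0" "f y \<noteq> f z"
    and inv: "\<And>s y. \<forall>j. y $ j \<noteq> 0 \<Longrightarrow> exchange_poly (\<Omega>\<lparr>cluster := y\<rparr>) s \<noteq> 0 \<Longrightarrow>
        f (cluster (mutate s (\<Omega>\<lparr>cluster := y\<rparr>))) = f y"
    using assms(1) unfolding has_invariant_def by blast
  obtain F where F: "\<And>y. \<forall>j. y $ j \<noteq> 0 \<Longrightarrow> eval_laurent3 F y = f y"
    using f(1) unfolding laurent_fun_def by blast
  let ?S = "Collect free_generators"
  let ?H = "{cluster_mutation \<Omega> s |s. s \<in> {1, 2, 3}}"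
  have "g \<in> Bij ?S \<and> (\<forall>y\<in>?S. f (g y) = f y)" if "g \<in> generate (BijGroup ?S) ?H" for g
  proof (rule generate_BijGroup_invariant[OF that])
    fix g and y :: "'k^3" assume "g \<in> ?H" and y: "y \<in> ?S"
    then obtain s where g: "g = cluster_mutation \<Omega> s" by blast
    show "g (g y) = y"
      unfolding g using cluster_mutation_Bij(2)[OF assms(3,4)] y by blast
    show "f (g y) = f y"
      using y inv by (simp add: g cluster_mutation_def free_generators_nonzero
          exchange_poly_nonzero assms(4))
  qed (use cluster_mutation_Bij(1)[OF assms(3,4)] in blast)
  then have group: "g \<in> Bij ?S" "\<forall>y\<in>?S. f (g y) = f y" if "g \<in> mutation_group \<Omega>" for g
    using that unfolding mutation_group_def by blast+
  have "F \<in> invariant_ring \<Omega>"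
    unfolding invariant_ring_def
  proof (intro CollectI ballI)
    fix g assume g: "g \<in> mutation_group \<Omega>"
    then have "g (cluster \<Omega>) \<in> ?S"
      using Bij_imp_funcset[OF group(1)] assms(2) by blast
    then show "eval_laurent3 F (g (cluster \<Omega>)) = eval_laurent3 F (cluster \<Omega>)"
      using group(2)[OF g] assms(2) by (simp add: F free_generators_nonzero)
  qed
  moreover have "F \<notin> constant_laurent3"
  proof
    assume "F \<in> constant_laurent3"
    then obtain c where "F = Poly_Mapping.single 0 c"
      by (auto simp: constant_laurent3_def)
    then have "eval_laurent3 F y = eval_laurent3 F z"
      by (simp add: eval_laurent3_mapping eval_mapping_single)
    with f show False by (simp add: F)
  qed
  ultimately show ?thesis by blast
qed

section \<open>Permuting and negating seeds\<close>

lemma permute_seed_permute_seed: "permute_seed \<sigma> (permute_seed \<tau> \<Omega>) = permute_seed (\<tau> \<circ> \<sigma>) \<Omega>"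
  by (simp add: permute_seed_def permute_matrix_def vec_eq_iff)

lemma permute_seed_id [simp]: "permute_seed id \<Omega> = \<Omega>"
  by (simp add: permute_seed_def permute_matrix_def vec_eq_iff)

lemma mutate_matrix_permute:
  assumes "bij \<sigma>"
  shows "mutate_matrix (\<chi> i. R $ \<sigma> i) s (permute_matrix \<sigma> B) =
    permute_matrix \<sigma> (mutate_matrix R (\<sigma> s) B)"
  using bij_is_inj[OF assms]
  by (simp add: mutate_matrix_def permute_matrix_def vec_eq_iff inj_eq)

lemma exchange_poly_permute:
  assumes "bij \<sigma>"
  shows "exchange_poly (permute_seed \<sigma> \<Omega>) s = exchange_poly \<Omega> (\<sigma> s)"
proof -
  have "(\<Prod>j\<in>UNIV. h (\<sigma> j)) = (\<Prod>j\<in>UNIV. h j)" for h :: "3 \<Rightarrow> 'a"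
    by (rule prod.reindex_bij_betw[OF assms])
  from this[of "\<lambda>j. cluster \<Omega> $ j powi (int i * pos_part (exch \<Omega> $ j $ \<sigma> s) +
      int (degs \<Omega> $ \<sigma> s - i) * pos_part (- (exch \<Omega> $ j $ \<sigma> s)))" for i]
  show ?thesis
    unfolding exchange_poly_def permute_seed_def permute_matrix_def
    by (simp only: seed.select_convs vec_lambda_beta)
qed

lemma mutate_permute:
  assumes "bij \<sigma>"
  shows "mutate s (permute_seed \<sigma> \<Omega>) = permute_seed \<sigma> (mutate (\<sigma> s) \<Omega>)"
proof -
  have "mutate s (permute_seed \<sigma> \<Omega>) = \<lparr>
     exch = permute_matrix \<sigma> (mutate_matrix (degs \<Omega>) (\<sigma> s) (exch \<Omega>)),
     cluster = (\<chi> j. if j = s then exchange_poly \<Omega> (\<sigma> s) / cluster \<Omega> $ \<sigma> s else cluster \<Omega> $ \<sigma> j),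
     degs = (\<chi> i. degs \<Omega> $ \<sigma> i), polys = (\<chi> i. polys \<Omega> $ \<sigma> i)\<rparr>"
    unfolding mutate_def exchange_poly_permute[OF assms]
    by (simp add: permute_seed_def mutate_matrix_permute[OF assms] cong: if_cong)
  then show ?thesis
    using bij_is_inj[OF assms] by (simp add: mutate_def permute_seed_def inj_eq)
qed

text \<open>Mutation in direction \<open>s\<close> of the permuted seed is mutation in direction
  \<sigma> s of the original one, so composing the invariant with the inverse permutation
  works.\<close>

lemma has_invariant_permute:
  assumes "has_invariant \<Omega>" "bij \<sigma>"
  shows "has_invariant (permute_seed \<sigma> \<Omega>)"
proof -
  obtain f y z where f: "laurent_fun f" "\<forall>j. y $ j \<noteq> 0" "\<forall>j. z $ j \<noteq> 0" "f y \<noteq> f z"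
    and inv: "\<And>s y. \<forall>j. y $ j \<noteq> 0 \<Longrightarrow> exchange_poly (\<Omega>\<lparr>cluster := y\<rparr>) s \<noteq> 0 \<Longrightarrow>
        f (cluster (mutate s (\<Omega>\<lparr>cluster := y\<rparr>))) = f y"
    using assms(1) unfolding has_invariant_def by blast
  obtain \<tau> where \<tau>: "\<And>i. \<sigma> (\<tau> i) = i" "\<And>i. \<tau> (\<sigma> i) = i"
    using assms(2) by (metis bij_pointE)
  define f' where "f' = (\<lambda>y. f (\<chi> i. y $ \<tau> i))"
  have "laurent_fun f'"
    unfolding f'_def by (rule laurent_fun_permute[OF f(1)])
  moreover have "f' (\<chi> i. y $ \<sigma> i) \<noteq> f' (\<chi> i. z $ \<sigma> i)"
    using f(4) by (simp add: f'_def \<tau>)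
  moreover have "f' (cluster (mutate s (permute_seed \<sigma> \<Omega>\<lparr>cluster := w\<rparr>))) = f' w"
    if w: "\<forall>j. w $ j \<noteq> 0" "exchange_poly (permute_seed \<sigma> \<Omega>\<lparr>cluster := w\<rparr>) s \<noteq> 0" for s w
  proof -
    have eq: "permute_seed \<sigma> \<Omega>\<lparr>cluster := w\<rparr> = permute_seed \<sigma> (\<Omega>\<lparr>cluster := (\<chi> i. w $ \<tau> i)\<rparr>)"
      by (simp add: permute_seed_def \<tau>)
    have "f (cluster (mutate (\<sigma> s) (\<Omega>\<lparr>cluster := (\<chi> i. w $ \<tau> i)\<rparr>))) = f (\<chi> i. w $ \<tau> i)"
      using w unfolding eq exchange_poly_permute[OF assms(2)] by (intro inv) auto
    then show ?thesis
      unfolding eq mutate_permute[OF assms(2)] by (simp add: f'_def permute_seed_def \<tau>)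
  qed
  moreover have "\<forall>j. (\<chi> i. y $ \<sigma> i) $ j \<noteq> 0" "\<forall>j. (\<chi> i. z $ \<sigma> i) $ j \<noteq> 0"
    using f by simp_all
  ultimately show ?thesis
    unfolding has_invariant_def by blast
qed

lemma opposite_simps [simp]:
  "exch (opposite \<Omega>) = - exch \<Omega>" "cluster (opposite \<Omega>) = cluster \<Omega>"
  "degs (opposite \<Omega>) = degs \<Omega>" "polys (opposite \<Omega>) = polys \<Omega>"
  "opposite (opposite \<Omega>) = \<Omega>"
  by (simp_all add: opposite_def)

text \<open>Negating the matrix swaps the two positive parts, which has the effect of replacing i by
  r - i in the sum; palindromic coefficients absorb this.\<close>

lemma exchange_poly_opposite:
  assumes "\<forall>i\<le>degs \<Omega> $ s. coeff (polys \<Omega> $ s) i = coeff (polys \<Omega> $ s) (degs \<Omega> $ s - i)"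
  shows "exchange_poly (opposite \<Omega>) s = exchange_poly \<Omega> s"
proof -
  let ?r = "degs \<Omega> $ s"
  let ?t = "\<lambda>\<Omega> i. of_nat (coeff (polys \<Omega> $ s) i) *
     (\<Prod>j\<in>UNIV. (cluster \<Omega> $ j) powi
        (int i * pos_part (exch \<Omega> $ j $ s) + int (degs \<Omega> $ s - i) * pos_part (- (exch \<Omega> $ j $ s))))"
  have reverse: "(\<Sum>i\<le>?r. h i) = (\<Sum>i\<le>?r. h (?r - i))" for h :: "nat \<Rightarrow> 'a"
    by (rule sum.reindex_bij_witness[where i = "\<lambda>i. ?r - i" and j = "\<lambda>i. ?r - i"]) auto
  have "?t \<Omega> (?r - i) = ?t (opposite \<Omega>) i" if "i \<le> ?r" for i
  proof -
    have "?r - (?r - i) = i" "coeff (polys \<Omega> $ s) (?r - i) = coeff (polys \<Omega> $ s) i"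
      using that by simp (rule assms[rule_format, OF that, symmetric])
    then show ?thesis
      by (simp only: opposite_simps vector_uminus_component minus_minus add.commute)
  qed
  then have "(\<Sum>i\<le>?r. ?t \<Omega> i) = (\<Sum>i\<le>?r. ?t (opposite \<Omega>) i)"
    by (subst reverse) (rule sum.cong, simp_all only: atMost_iff)
  then show ?thesis
    by (simp add: exchange_poly_def opposite_def)
qed

lemma has_invariant_opposite:
  assumes "has_invariant \<Omega>"
    and "\<And>s. \<forall>i\<le>degs \<Omega> $ s. coeff (polys \<Omega> $ s) i = coeff (polys \<Omega> $ s) (degs \<Omega> $ s - i)"
  shows "has_invariant (opposite \<Omega>)"
proof -
  have "exchange_poly (opposite \<Omega>\<lparr>cluster := y\<rparr>) s = exchange_poly (\<Omega>\<lparr>cluster := y\<rparr>) s" for y s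
  proof -
    have eqs: "degs (\<Omega>\<lparr>cluster := y\<rparr>) = degs \<Omega>" "polys (\<Omega>\<lparr>cluster := y\<rparr>) = polys \<Omega>"
      by simp_all
    have "exchange_poly (opposite (\<Omega>\<lparr>cluster := y\<rparr>)) s = exchange_poly (\<Omega>\<lparr>cluster := y\<rparr>) s"
      by (rule exchange_poly_opposite) (unfold eqs, rule assms(2))
    moreover have "opposite (\<Omega>\<lparr>cluster := y\<rparr>) = opposite \<Omega>\<lparr>cluster := y\<rparr>"
      by (rule seed.equality) simp_all
    ultimately show ?thesis by simp
  qed
  then show ?thesis
    using assms(1) unfolding has_invariant_def by (simp add: cluster_mutate cong: if_cong)
qed

section \<open>Invariants of the listed seeds\<close>

lemma UNIV_3_distinct:
  assumes "distinct [i, j, k :: 3]"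
  shows "UNIV = {i, j, k}"
proof -
  have "card {i, j, k} = CARD(3)" using assms by simp
  then show ?thesis by (metis card_eq_UNIV_imp_eq_UNIV finite)
qed

text \<open>The map t + (2 + c) / t takes its value at 1 only at 1 and at 2 + c. As the field has no
  order, 2^-n is told apart from these by multiplying with 2^n and comparing natural
  numbers.\<close>

lemma vieta_not_constant:
  fixes t :: "'k::field_char_0"
  assumes "t = (1 / 2) ^ n" "n > 0"
  shows "t + (2 + of_nat c) / t \<noteq> 1 + (2 + of_nat c)"
proof
  assume eq: "t + (2 + of_nat c) / t = 1 + (2 + of_nat c)"
  have t: "t * 2 ^ n = 1"
    unfolding assms(1) by (simp flip: power_mult_distrib)
  then have "t \<noteq> 0" by auto
  with eq have "t * t + (2 + of_nat c) = (1 + (2 + of_nat c)) * t"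
    by (simp add: field_simps)
  then have "(t - 1) * (t - (2 + of_nat c)) = 0"
    by (simp add: algebra_simps)
  then have "t = 1 \<or> t = of_nat (2 + c)"
    by auto
  moreover have "of_nat (2 ^ n) = (1::'k)" if "t = 1"
    using t that by simp
  moreover have "of_nat ((2 + c) * 2 ^ n) = (1::'k)" if "t = of_nat (2 + c)"
    using t that by (simp only: of_nat_mult of_nat_power of_nat_numeral)
  ultimately have "of_nat (2 ^ n) = (1::'k) \<or> of_nat ((2 + c) * 2 ^ n) = (1::'k)"
    by blast
  then have "2 ^ n = (1::nat) \<or> (2 + c) * 2 ^ n = (1::nat)"
    using of_nat_eq_1_iff by blast
  then show False
    unfolding nat_mult_eq_1_iff using assms(2) by auto
qed

text \<open>As a quadratic in a, the numerator has constant term a a'. The quotient is therefore a +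
  a' + k2 c + k3 b, which is symmetric in a and a'.\<close>

lemma markov_vieta:
  fixes a b c :: "'k::field"
  assumes "a * a' = b^2 + k1 * b * c + c^2" "a \<noteq> 0" "a' \<noteq> 0"
  shows "(a'^2 + b^2 + c^2 + k1 * b * c + k2 * a' * c + k3 * a' * b) / a' =
    (a^2 + b^2 + c^2 + k1 * b * c + k2 * a * c + k3 * a * b) / a"
proof -
  have "(x^2 + b^2 + c^2 + k1 * b * c + k2 * x * c + k3 * x * b) / x =
      x + x' + k2 * c + k3 * b" if "x * x' = b^2 + k1 * b * c + c^2" "x \<noteq> 0" for x x'
  proof -
    have "x^2 + b^2 + c^2 + k1 * b * c + k2 * x * c + k3 * x * b =
        x^2 + x * x' + k2 * x * c + k3 * x * b"
      unfolding that(1) by (simp add: algebra_simps)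
    also have "\<dots> = x * (x + x' + k2 * c + k3 * b)"
      by (simp add: algebra_simps power2_eq_square)
    finally show ?thesis using that(2) by simp
  qed
  from this[of a a'] this[of a' a] assms show ?thesis
    by (simp add: mult.commute add.commute)
qed

text \<open>In the coordinates \<open>u\<^sub>j = y\<^sub>j ^ n\<^sub>j\<close> the three mutations are the Vieta involutions of the
  generalized Markov equation, and the invariant is its quotient form.\<close>

lemma has_invariant_markov:
  fixes \<Omega> :: "'k::field_char_0 seed"
  assumes "n1 > 0"
    and P1: "\<And>y. \<forall>j. y $ j \<noteq> 0 \<Longrightarrow> exchange_poly (\<Omega>\<lparr>cluster := y\<rparr>) 1 ^ n1 =
      (y $ 2 ^ n2)^2 + of_nat k1 * y $ 2 ^ n2 * y $ 3 ^ n3 + (y $ 3 ^ n3)^2"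
    and P2: "\<And>y. \<forall>j. y $ j \<noteq> 0 \<Longrightarrow> exchange_poly (\<Omega>\<lparr>cluster := y\<rparr>) 2 ^ n2 =
      (y $ 1 ^ n1)^2 + of_nat k2 * y $ 1 ^ n1 * y $ 3 ^ n3 + (y $ 3 ^ n3)^2"
    and P3: "\<And>y. \<forall>j. y $ j \<noteq> 0 \<Longrightarrow> exchange_poly (\<Omega>\<lparr>cluster := y\<rparr>) 3 ^ n3 =
      (y $ 1 ^ n1)^2 + of_nat k3 * y $ 1 ^ n1 * y $ 2 ^ n2 + (y $ 2 ^ n2)^2"
  shows "has_invariant \<Omega>"
proof -
  define h :: "'k \<Rightarrow> 'k \<Rightarrow> 'k \<Rightarrow> 'k \<Rightarrow> 'k \<Rightarrow> 'k \<Rightarrow> 'k"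
    where "h = (\<lambda>k1 k2 k3 a b c.
      (a^2 + b^2 + c^2 + k1 * b * c + k2 * a * c + k3 * a * b) / a / b / c)"
  have h1: "h k1 k2 k3 a' b c = h k1 k2 k3 a b c"
    if "a * a' = b^2 + k1 * b * c + c^2" "a \<noteq> 0" "a' \<noteq> 0" for k1 k2 k3 a a' b c
    unfolding h_def by (simp only: markov_vieta[OF that, of k2 k3])
  \<comment> \<open>Permuting variables and parameters together fixes \<open>h\<close>, so the first
    Vieta involution yields the other two.\<close>
  have swap: "h k1 k2 k3 a b c = h k2 k1 k3 b a c" "h k1 k2 k3 a b c = h k3 k2 k1 c b a"
    for k1 k2 k3 a b c
    by (simp_all add: h_def algebra_simps)
  have h2: "h k1 k2 k3 a b' c = h k1 k2 k3 a b c"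
    if "b * b' = a^2 + k2 * a * c + c^2" "b \<noteq> 0" "b' \<noteq> 0" for k1 k2 k3 a b b' c
    unfolding swap(1)[of k1 k2 k3] by (rule h1[OF that])
  have h3: "h k1 k2 k3 a b c' = h k1 k2 k3 a b c"
    if "c * c' = a^2 + k3 * a * b + b^2" "c \<noteq> 0" "c' \<noteq> 0" for k1 k2 k3 a b c c'
    unfolding swap(2)[of k1 k2 k3] by (rule h1) (use that in \<open>simp_all add: algebra_simps\<close>)
  let ?h = "h (of_nat k1) (of_nat k2) (of_nat k3)"
  let ?f = "\<lambda>y::'k^3. ?h (y $ 1 ^ n1) (y $ 2 ^ n2) (y $ 3 ^ n3)"
  let ?t = "(1 / 2) ^ n1 :: 'k"
  have "laurent_fun ?f"
    unfolding h_def by (intro laurent_fun_intros)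
  \<comment> \<open>With the last two coordinates equal to 1, the quotient is u + (2 + k1) / u plus
    a constant, where u is the power \<open>n1\<close> of the first coordinate.\<close>
  moreover have "?f (vector [1 / 2, 1, 1]) \<noteq> ?f (vector [1, 1, 1])"
  proof -
    have "?t \<noteq> 0" by simp
    then have "?h ?t 1 1 = ?t + (2 + of_nat k1) / ?t + of_nat k2 + of_nat k3"
      unfolding h_def by (simp add: add_divide_distrib power2_eq_square algebra_simps
          del: power_one_over)
    then show ?thesis
      using vieta_not_constant[of ?t n1 k1, OF refl assms(1)]
      by (simp add: h_def algebra_simps)
  qed
  moreover have "?f (cluster (mutate s (\<Omega>\<lparr>cluster := y\<rparr>))) = ?f y"
    if y: "\<forall>j. y $ j \<noteq> 0" "exchange_poly (\<Omega>\<lparr>cluster := y\<rparr>) s \<noteq> 0" for s y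
  proof -
    consider "s = 1" | "s = 2" | "s = 3" using exhaust_3 by blast
    then show ?thesis
    proof cases
      case 1
      with y P1[OF y(1)] show ?thesis
        by (simp add: cluster_mutate) (rule h1, simp add: power_divide, simp_all)
    next
      case 2
      with y P2[OF y(1)] show ?thesis
        by (simp add: cluster_mutate) (rule h2, simp add: power_divide, simp_all)
    next
      case 3
      with y P3[OF y(1)] show ?thesis
        by (simp add: cluster_mutate) (rule h3, simp add: power_divide, simp_all)
    qed
  qed
  moreover have "\<forall>j. (vector [1 / 2, 1, 1] :: 'k^3) $ j \<noteq> 0" "\<forall>j. (vector [1, 1, 1] :: 'k^3) $ j \<noteq> 0"
    by (simp_all add: forall_3)
  ultimately show ?thesis
    unfolding has_invariant_def by blast
qed

text \<open>With \<open>w = a + b\<^sup>2 + c\<^sup>2\<close>, the element \<open>w / b\<close> equals \<open>b + b'\<close>, where \<open>b' = (a + c\<^sup>2) / b\<close> is the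
  mutation of \<open>b\<close>; symmetrically for \<open>c\<close>. So \<open>w\<^sup>2 / (a b\<^sup>2 c\<^sup>2)\<close>, \<open>w / (a b c)\<close> and \<open>1 / a\<close> are
  invariant under the last two mutations, and the combination below is made palindromic in \<open>a\<close>.\<close>

lemma has_invariant_quartic:
  fixes \<Omega> :: "'k::field_char_0 seed"
  assumes "n > 0" and pqr: "distinct [p, q, r]"
    and Pp: "\<And>y. \<forall>j. y $ j \<noteq> 0 \<Longrightarrow> exchange_poly (\<Omega>\<lparr>cluster := y\<rparr>) p ^ n =
      y $ q ^ 4 + of_nat k1 * y $ q ^ 3 * y $ r + of_nat k2 * y $ q ^ 2 * y $ r ^ 2 +
      of_nat k1 * y $ q * y $ r ^ 3 + y $ r ^ 4"
    and Pq: "\<And>y. \<forall>j. y $ j \<noteq> 0 \<Longrightarrow> exchange_poly (\<Omega>\<lparr>cluster := y\<rparr>) q = y $ p ^ n + y $ r ^ 2"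
    and Pr: "\<And>y. \<forall>j. y $ j \<noteq> 0 \<Longrightarrow> exchange_poly (\<Omega>\<lparr>cluster := y\<rparr>) r = y $ p ^ n + y $ q ^ 2"
  shows "has_invariant \<Omega>"
proof -
  define h :: "'k \<Rightarrow> 'k \<Rightarrow> 'k \<Rightarrow> 'k" where "h = (\<lambda>a b c.
    ((a + b^2 + c^2)^2 + of_nat k1 * b * c * (a + b^2 + c^2) + (of_nat k2 - 2) * b^2 * c^2)
      / a / b^2 / c^2)"
  have h1: "h a' b c = h a b c"
    if "a * a' = b^4 + of_nat k1 * b^3 * c + of_nat k2 * b^2 * c^2 + of_nat k1 * b * c^3 + c^4"
      "a \<noteq> 0" "a' \<noteq> 0" for a a' b c
  proof -
    \<comment> \<open>Vieta again: the constant term in x is (b^2 + c^2)^2 + k1 b c (b^2 + c^2) +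
      (k2 - 2) b^2 c^2, which is the quartic x x'; the -2 offsets the mixed term of the
      square.\<close>
    have "((x + b^2 + c^2)^2 + of_nat k1 * b * c * (x + b^2 + c^2) + (of_nat k2 - 2) * b^2 * c^2) / x =
        x + x' + 2 * (b^2 + c^2) + of_nat k1 * b * c"
      if "x * x' = b^4 + of_nat k1 * b^3 * c + of_nat k2 * b^2 * c^2 + of_nat k1 * b * c^3 + c^4"
        "x \<noteq> 0" for x x'
    proof -
      have "(x + b^2 + c^2)^2 + of_nat k1 * b * c * (x + b^2 + c^2) + (of_nat k2 - 2) * b^2 * c^2 =
          x^2 + 2 * x * (b^2 + c^2) + of_nat k1 * b * c * x + x * x'"
        unfolding that(1) by algebra
      also have "\<dots> = x * (x + x' + 2 * (b^2 + c^2) + of_nat k1 * b * c)"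
        by algebra
      finally show ?thesis using that(2) by simp
    qed
    from this[of a a'] this[of a' a] that show ?thesis
      unfolding h_def by (simp only: simp_thms mult.commute[of a' a] add.commute[of a' a])
  qed
  \<comment> \<open>In this form b enters only through w / b, so invariance of w / b suffices for
    the second mutation.\<close>
  have h_eq: "h a b c = (((a + b^2 + c^2) / b)^2 + of_nat k1 * c * ((a + b^2 + c^2) / b) +
      (of_nat k2 - 2) * c^2) / a / c^2" if "b \<noteq> 0" for a b c
  proof -
    have "(w / b)^2 + k * c * (w / b) + m * c^2 = (w^2 + k * b * c * w + m * b^2 * c^2) / b^2"
      for w k m
      using that by (simp add: field_simps power2_eq_square)
    then show ?thesis
      by (simp add: h_def)
  qed
  have h2: "h a b' c = h a b c" if b: "b * b' = a + c^2" "b \<noteq> 0" "b' \<noteq> 0" for a b b' c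
  proof -
    have "(a + x^2 + c^2) / x = x + x'" if "x * x' = a + c^2" "x \<noteq> 0" for x x'
    proof -
      have "a + x^2 + c^2 = x * (x + x')"
        using that(1) by algebra
      then show ?thesis using that(2) by simp
    qed
    from this[of b b'] this[of b' b] b show ?thesis
      by (simp only: simp_thms h_eq mult.commute[of b' b] add.commute[of b' b])
  qed
  have h_swap: "h a b c = h a c b" for a b c
    by (simp add: h_def algebra_simps)
  have h3: "h a b c' = h a b c" if "c * c' = a + b^2" "c \<noteq> 0" "c' \<noteq> 0" for a b c c'
    unfolding h_swap[of a b] by (rule h2[OF that])
  let ?f = "\<lambda>y::'k^3. h (y $ p ^ n) (y $ q) (y $ r)"
  let ?t = "(1 / 2) ^ n :: 'k"
  let ?y = "(\<chi> j. if j = p then 1 / 2 else 1) :: 'k^3"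
  have "laurent_fun ?f"
    unfolding h_def by (intro laurent_fun_intros)
  moreover have "?f ?y \<noteq> ?f (\<chi> j. 1)"
  proof -
    have "?t \<noteq> 0" by simp
    \<comment> \<open>The value at b = c = 1, arranged so that \<open>vieta_not_constant\<close>
      applies with 2 k1 + k2 as its parameter.\<close>
    have "(x + 2)^2 + of_nat k1 * (x + 2) + (of_nat k2 - 2) =
        x * (x + 4 + of_nat k1) + (2 + of_nat (2 * k1 + k2))" for x :: 'k
      by (simp add: algebra_simps power2_eq_square)
    then have "h x 1 1 = x + (2 + of_nat (2 * k1 + k2)) / x + (4 + of_nat k1)" if "x \<noteq> 0" for x
      using that unfolding h_def by (simp add: add_divide_distrib add.assoc)
    from this[OF \<open>?t \<noteq> 0\<close>] this[of 1] show ?thesis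
      using vieta_not_constant[of ?t n "2 * k1 + k2", OF refl assms(1)] pqr
      by (auto simp del: power_one_over)
  qed
  moreover have "?f (cluster (mutate s (\<Omega>\<lparr>cluster := y\<rparr>))) = ?f y"
    if y: "\<forall>j. y $ j \<noteq> 0" "exchange_poly (\<Omega>\<lparr>cluster := y\<rparr>) s \<noteq> 0" for s y
  proof -
    have neq: "p \<noteq> q" "q \<noteq> p" "p \<noteq> r" "r \<noteq> p" "q \<noteq> r" "r \<noteq> q"
      using pqr by auto
    consider "s = p" | "s = q" | "s = r"
      using UNIV_3_distinct[OF pqr] by blast
    then show ?thesis
    proof cases
      case 1
      with y neq Pp[OF y(1)] show ?thesis
        by (simp add: cluster_mutate) (rule h1, simp add: power_divide, simp_all)
    next
      case 2
      with y neq Pq[OF y(1)] show ?thesis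
        by (simp add: cluster_mutate) (rule h2, simp_all)
    next
      case 3
      with y neq Pr[OF y(1)] show ?thesis
        by (simp add: cluster_mutate) (rule h3, simp_all)
    qed
  qed
  moreover have "\<forall>j. ?y $ j \<noteq> 0" "\<forall>j. (\<chi> j. 1 :: 'k^3) $ j \<noteq> 0"
    by simp_all
  ultimately show ?thesis
    unfolding has_invariant_def by blast
qed

lemma sum_atMost_small:
  fixes f :: "nat \<Rightarrow> 'a::comm_monoid_add"
  shows "sum f {..Suc 0} = f 0 + f 1" "sum f {..2} = f 0 + f 1 + f 2"
    "sum f {..4} = f 0 + f 1 + f 2 + f 3 + f 4"
  by (simp_all add: numeral_eq_Suc)

lemma prod_UNIV_3: "prod f (UNIV :: 3 set) = f 1 * f 2 * f 3"
  unfolding UNIV_3 by (simp add: ac_simps)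

lemmas exchange_poly_simps = exchange_poly_def sum_atMost_small coeff_pCons mat3_def pos_part_def
  prod_UNIV_3

text \<open>In the Markov cases, degree 2 goes with exponent 1 and keeps its own parameter. Degree 1
  has parameter 0 with exponent 1, and parameter 2 with exponent 2, from squaring a
  binomial.\<close>

lemma Omega3_has_invariant: "Omega3 i \<Omega> \<Longrightarrow> has_invariant \<Omega>"
proof (induction rule: Omega3.induct)
  case (1 x)
  show ?case
    by (rule has_invariant_markov[of 2 _ 2 2 2 2 2]; simp add: exchange_poly_simps;
        simp add: power2_eq_square power3_eq_cube power4_eq_xxxx algebra_simps)
next
  case (2 x k3)
  show ?case
    \<comment> \<open>The coefficients are those of (1 + k3 u + u^2)^2.\<close>
    by (rule has_invariant_quartic[of 2 3 1 2 _ "2 * k3" "k3^2 + 2"];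
        simp add: exchange_poly_simps;
        simp add: power2_eq_square power3_eq_cube power4_eq_xxxx algebra_simps)
next
  case (3 x k1 k3)
  show ?case
    by (rule has_invariant_markov[of 1 _ 1 k1 1 0 k3]; simp add: exchange_poly_simps)
next
  case (4 x k1 k2 k3)
  show ?case
    by (rule has_invariant_markov[of 1 _ 1 k1 1 k2 k3]; simp add: exchange_poly_simps)
next
  case (5 x)
  show ?case
    by (rule has_invariant_markov[of 1 _ 2 0 2 2 2]; simp add: exchange_poly_simps;
        simp add: power2_eq_square power3_eq_cube power4_eq_xxxx algebra_simps)
next
  case (6 x k)
  show ?case
    by (rule has_invariant_markov[of 1 _ 2 k 2 2 2]; simp add: exchange_poly_simps;
        simp add: power2_eq_square power3_eq_cube power4_eq_xxxx algebra_simps)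
next
  case (7 x k1 k2)
  show ?case
    by (rule has_invariant_quartic[of 1 1 2 3 _ k1 k2]; simp add: exchange_poly_simps;
        simp add: power2_eq_square power3_eq_cube power4_eq_xxxx algebra_simps)
next
  case (8 x)
  show ?case
    \<comment> \<open>The coefficients 4 and 6 are binomial: the exchange polynomial in direction 1
      is a sum of two variables, raised to the fourth power.\<close>
    by (rule has_invariant_quartic[of 4 1 2 3 _ 4 6]; simp add: exchange_poly_simps;
        simp add: power2_eq_square power3_eq_cube power4_eq_xxxx algebra_simps)
next
  case (9 x k2)
  show ?case
    by (rule has_invariant_markov[of 2 _ 1 2 1 k2 0]; simp add: exchange_poly_simps;
        simp add: power2_eq_square power3_eq_cube power4_eq_xxxx algebra_simps)
next
  case (10 x k2 k3)
  show ?case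
    by (rule has_invariant_markov[of 2 _ 1 2 1 k2 k3]; simp add: exchange_poly_simps;
        simp add: power2_eq_square power3_eq_cube power4_eq_xxxx algebra_simps)
qed

section \<open>Exchange matrices reversed by every mutation\<close>

definition reversed_by_mutations :: "nat^3 \<Rightarrow> int^3^3 \<Rightarrow> bool" where
  "reversed_by_mutations R B \<longleftrightarrow> (\<forall>i. B $ i $ i = 0) \<and> (\<forall>i j. i \<noteq> j \<longrightarrow> B $ i $ j * B $ j $ i < 0) \<and>
     (\<forall>i j k. distinct [i, j, k] \<longrightarrow> int (R $ j) * B $ i $ j * \<bar>B $ j $ k\<bar> = - 2 * B $ i $ k)"

text \<open>Skew-symmetry of S B reads s_j b_ji = - s_i b_ij with positive s_i and s_j.\<close>

lemma skew_symmetrizable_sign: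
  assumes "skew_symmetrizable B"
  shows "sgn (B $ j $ i) = - sgn (B $ i $ j)"
proof -
  obtain S where S: "\<forall>i j. i \<noteq> j \<longrightarrow> S $ i $ j = 0" "\<forall>i. S $ i $ i > 0"
    and skew: "transpose (S ** B) = - (S ** B)"
    using assms unfolding skew_symmetrizable_def by blast
  have "(S ** B) $ i $ j = S $ i $ i * B $ i $ j" for i j
  proof -
    have "(\<Sum>k\<in>UNIV - {i}. S $ i $ k * B $ k $ j) = 0"
      by (rule sum.neutral) (use S(1) in auto)
    then show ?thesis
      by (simp add: matrix_matrix_mult_def sum.remove[where x = i])
  qed
  then have "S $ j $ j * B $ j $ i = - (S $ i $ i * B $ i $ j)"
    using arg_cong[OF skew, of "\<lambda>M. M $ i $ j"] by (simp add: transpose_def)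
  then have "sgn (S $ j $ j * B $ j $ i) = sgn (- (S $ i $ i * B $ i $ j))"
    by (rule arg_cong)
  then show ?thesis
    using S(2) by (simp add: sgn_mult)
qed

text \<open>If column \<open>s\<close> vanished off the diagonal, moving \<open>s\<close> to the
  first position would give a block triangular form with blocks of sizes 1 and 2.\<close>

lemma irreducible_matrix_column:
  fixes B :: "int^3^3"
  assumes "irreducible_matrix B"
  obtains j where "j \<noteq> s" "B $ j $ s \<noteq> 0"
proof -
  have "\<exists>j. j \<noteq> s \<and> B $ j $ s \<noteq> 0"
  proof (rule ccontr)
    assume zero: "\<not> ?thesis"
    define \<sigma> where "\<sigma> = Transposition.transpose 1 s"
    define \<beta> :: "nat \<Rightarrow> nat" where "\<beta> = (\<lambda>n. if n = 1 then 0 else 1)"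
    have \<sigma>: "bij \<sigma>" "\<sigma> 1 = s" "\<And>k. k \<noteq> 1 \<Longrightarrow> \<sigma> k \<noteq> s"
      unfolding \<sigma>_def by (auto simp: transpose_eq_iff)
    have "{1..3} = {1, 2, 3 :: nat}" by auto
    then have "\<beta> ` {1..3} = {0, 1}" by (auto simp: \<beta>_def)
    moreover have "block_upper_triangular \<beta> (permute_matrix \<sigma> B)"
      unfolding block_upper_triangular_def
    proof (intro conjI ballI impI)
      show "mono_on {1..3} \<beta>"
        by (auto simp: \<beta>_def mono_on_def)
      fix m n :: nat
      assume "m \<in> {1..3}" "n \<in> {1..3}" "\<beta> n < \<beta> m"
      then have n: "n = 1" and "m = 2 \<or> m = 3"
        by (auto simp: \<beta>_def split: if_splits)
      then have "of_nat m \<noteq> (1::3)"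
        by auto
      then show "permute_matrix \<sigma> B $ of_nat m $ of_nat n = 0"
        using zero \<sigma>(2) \<sigma>(3)[of "of_nat m"] by (auto simp: n permute_matrix_def)
    qed
    ultimately show False
      using assms \<sigma>(1) unfolding irreducible_matrix_def by (metis card_2_iff le_refl zero_neq_one)
  qed
  then show thesis using that by blast
qed

text \<open>Membership yields some pair \<sigma>, t for which the composite equals
  \<open>mutate s\<close> as a function; evaluating this equality at \<Omega> avoids comparing the
  pair with the identity and \<open>s\<close>.\<close>

lemma cluster_symmetry_exch:
  fixes \<Omega> :: "'k::field seed"
  assumes "mutate s \<in> cluster_symmetries \<Omega>"
  shows "mutate_matrix (degs \<Omega>) s (exch \<Omega>) = exch \<Omega> \<or>
    mutate_matrix (degs \<Omega>) s (exch \<Omega>) = - exch \<Omega>"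
proof -
  obtain \<sigma> t x where eq: "mutate s = (permute_seed \<sigma> \<circ> mutate t :: 'k seed \<Rightarrow> 'k seed)"
    and "permute_seed \<sigma> (mutate t \<Omega>) = \<Omega>\<lparr>cluster := x\<rparr> \<or>
      permute_seed \<sigma> (mutate t \<Omega>) = \<Omega>\<lparr>exch := - exch \<Omega>, cluster := x\<rparr>"
    using assms unfolding cluster_symmetries_def mem_Collect_eq by (elim exE conjE) (rule that)
  then have "mutate s \<Omega> = \<Omega>\<lparr>cluster := x\<rparr> \<or> mutate s \<Omega> = \<Omega>\<lparr>exch := - exch \<Omega>, cluster := x\<rparr>"
    unfolding eq by simp
  then have "exch (mutate s \<Omega>) = exch \<Omega> \<or> exch (mutate s \<Omega>) = - exch \<Omega>"
    by auto
  then show ?thesis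
    by (simp add: mutate_def)
qed

lemma third_index:
  obtains k :: 3 where "k \<noteq> i" "k \<noteq> j"
proof -
  have "card {i, j} \<le> 2" by (simp add: card_insert_if)
  then have "{i, j} \<noteq> UNIV" by auto
  then show thesis using that by blast
qed

lemma reversed_by_mutationsI:
  assumes skew: "skew_symmetrizable B" and irred: "irreducible_matrix B"
    and mut: "\<And>s. mutate_matrix R s B = B \<or> mutate_matrix R s B = - B"
  shows "reversed_by_mutations R B"
proof -
  have sgn: "sgn (B $ j $ i) = - sgn (B $ i $ j)" for i j
    by (rule skew_symmetrizable_sign[OF skew])
  have diag: "B $ i $ i = 0" for i
    using sgn[of i i] by (simp add: sgn_if split: if_splits)
  have "mutate_matrix R s B = - B" for s
  proof -
    obtain j where "j \<noteq> s" "B $ j $ s \<noteq> 0"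
      using irreducible_matrix_column[OF irred] by blast
    \<comment> \<open>Mutation negates column \<open>s\<close>, so a nonzero entry in it excludes
      the sign +.\<close>
    then have "mutate_matrix R s B $ j $ s \<noteq> B $ j $ s"
      by (simp add: mutate_matrix_def)
    then show ?thesis using mut[of s] by auto
  qed
  then have mut_entry: "mutate_matrix R s B $ i $ j = - B $ i $ j" for s i j
    by simp
  have entry: "int (R $ s) * (pos_part (B $ i $ s) * B $ s $ j +
      B $ i $ s * pos_part (- (B $ s $ j))) = - 2 * B $ i $ j" if "i \<noteq> s" "j \<noteq> s" for i j s
  proof -
    have "mutate_matrix R s B $ i $ j = B $ i $ j + int (R $ s) *
        (pos_part (B $ i $ s) * B $ s $ j + B $ i $ s * pos_part (- (B $ s $ j)))"
      using that by (simp add: mutate_matrix_def)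
    with mut_entry[of s i j] show ?thesis by linarith
  qed
  have nonzero: "B $ i $ j \<noteq> 0" if "i \<noteq> j" for i j
  proof
    assume zero: "B $ i $ j = 0"
    obtain k where k: "k \<noteq> i" "k \<noteq> j" by (rule third_index)
    obtain l where "l \<noteq> j" "B $ l $ j \<noteq> 0"
      using irreducible_matrix_column[OF irred] by blast
    moreover have "l = i \<or> l = k"
      using UNIV_3_distinct[of i j k] k that \<open>l \<noteq> j\<close> by auto
    ultimately have "B $ k $ j \<noteq> 0"
      using zero by auto
    \<comment> \<open>With b_ij = 0, mutation in direction i leaves b_kj unchanged, yet it must
      negate it.\<close>
    moreover have "- 2 * B $ k $ j = 0"
      using entry[of k i j] k that zero by (simp add: pos_part_def)
    ultimately show False by simp
  qed
  have "B $ i $ j * B $ j $ i < 0" if "i \<noteq> j" for i j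
  proof -
    have "sgn (B $ i $ j * B $ j $ i) = - (sgn (B $ i $ j))\<^sup>2"
      by (simp add: sgn_mult sgn[of i j] power2_eq_square)
    also have "\<dots> = - 1"
      using nonzero[OF that] by (simp add: sgn_if)
    finally show ?thesis by (simp only: sgn_1_neg)
  qed
  moreover have "int (R $ j) * B $ i $ j * \<bar>B $ j $ k\<bar> = - 2 * B $ i $ k" if "distinct [i, j, k]" for i j k
  proof -
    have "i \<noteq> j" "k \<noteq> j" "i \<noteq> k" using that by auto
    \<comment> \<open>The bracket vanishes if b_ij and b_jk have opposite signs and is b_ij |b_jk|
      otherwise; b_ik being nonzero rules out the former.\<close>
    then have "pos_part (B $ i $ j) * B $ j $ k + B $ i $ j * pos_part (- (B $ j $ k)) \<noteq> 0"
      using entry[of i j k] nonzero[of i k] by auto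
    then have "pos_part (B $ i $ j) * B $ j $ k + B $ i $ j * pos_part (- (B $ j $ k)) =
        B $ i $ j * \<bar>B $ j $ k\<bar>"
      by (auto simp: pos_part_def max_def abs_if split: if_splits)
    then show ?thesis
      using entry[of i j k] \<open>i \<noteq> j\<close> \<open>k \<noteq> j\<close> by (simp add: mult.assoc)
  qed
  ultimately show ?thesis
    unfolding reversed_by_mutations_def using diag by blast
qed

section \<open>Symmetries and enumeration of the solutions\<close>

lemma reversed_by_mutations_permute:
  assumes "reversed_by_mutations R B" "bij \<sigma>"
  shows "reversed_by_mutations (\<chi> i. R $ \<sigma> i) (permute_matrix \<sigma> B)"
  using assms bij_is_inj[OF assms(2)]
  by (simp add: reversed_by_mutations_def permute_matrix_def inj_eq)

lemma reversed_by_mutations_uminus: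
  "reversed_by_mutations R B \<Longrightarrow> reversed_by_mutations R (- B)"
  by (simp add: reversed_by_mutations_def)

text \<open>The entries are \<open>r\<^sub>1, r\<^sub>2, r\<^sub>3, b\<^sub>1\<^sub>2, b\<^sub>2\<^sub>3, b\<^sub>3\<^sub>1, -b\<^sub>2\<^sub>1, -b\<^sub>3\<^sub>2, -b\<^sub>1\<^sub>3\<close>. The first ten tuples are those of the
  listed seeds; the last one is the opposite of the ninth with the indices 1 and 2 exchanged.\<close>

definition normal_tuples :: "(nat \<times> nat \<times> nat \<times> int \<times> int \<times> int \<times> int \<times> int \<times> int) set" where
  "normal_tuples = {
    (1,1,1, 2,2,2, 2,2,2), (1,1,2, 2,1,2, 2,2,1), (2,1,2, 2,1,1, 1,2,1), (2,2,2, 1,1,1, 1,1,1),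
    (1,1,1, 1,2,4, 4,2,1), (2,1,1, 1,2,2, 2,2,1), (4,1,1, 1,2,1, 1,2,1), (1,1,1, 4,2,1, 1,2,4),
    (1,2,1, 2,2,1, 1,1,4), (1,2,2, 2,1,1, 1,1,2), (2,1,1, 1,4,1, 2,1,2)}"

lemma nat_mult_eq_4_cases:
  fixes m n :: nat
  assumes "m * n = 4"
  shows "m \<in> {1, 2, 4}"
proof -
  have "m dvd 4" using assms by (metis dvd_triv_left)
  then have "m \<le> 4" by (simp add: dvd_imp_le)
  then consider "m = 0" | "m = 1" | "m = 2" | "m = 3" | "m = 4" by linarith
  then show ?thesis
    using assms by cases (simp_all, presburger)
qed

text \<open>Chaining two of the relations gives r1 r2 a a' = 4 and r2 r3 b b' = 4, which confines
  the degrees and a, b to 1, 2, 4.\<close>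

lemma rotate_to_normal_tuple:
  fixes r1 r2 r3 a b c a' b' c' :: nat
  assumes eqs: "r2 * a * b = 2 * c'" "r3 * b * c = 2 * a'" "r1 * c * a = 2 * b'"
    "r3 * c' * b' = 2 * a" "r1 * a' * c' = 2 * b" "r2 * b' * a' = 2 * c"
    and pos: "a > 0" "b > 0" "c > 0"
  shows "(r1, r2, r3, int a, int b, int c, int a', int b', int c') \<in> normal_tuples \<or>
    (r2, r3, r1, int b, int c, int a, int b', int c', int a') \<in> normal_tuples \<or>
    (r3, r1, r2, int c, int a, int b, int c', int a', int b') \<in> normal_tuples"
proof -
  have "(r1 * r2 * a * a') * b = r1 * a' * (r2 * a * b)" by simp
  also have "\<dots> = 2 * (r1 * a' * c')" unfolding eqs(1) by simp
  also have "\<dots> = 4 * b" unfolding eqs(5) by simp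
  finally have "r1 * r2 * a * a' = 4" using pos by simp
  then have "r1 \<in> {1, 2, 4}" "r2 \<in> {1, 2, 4}" "a \<in> {1, 2, 4}"
    using nat_mult_eq_4_cases[of r1 "r2 * a * a'"] nat_mult_eq_4_cases[of r2 "r1 * a * a'"]
      nat_mult_eq_4_cases[of a "r1 * r2 * a'"] by (simp_all add: mult_ac)
  have "(r2 * r3 * b * b') * c = r2 * b' * (r3 * b * c)" by simp
  also have "\<dots> = 2 * (r2 * b' * a')" unfolding eqs(2) by simp
  also have "\<dots> = 4 * c" unfolding eqs(6) by simp
  finally have "r2 * r3 * b * b' = 4" using pos by simp
  then have "r3 \<in> {1, 2, 4}" "b \<in> {1, 2, 4}"
    using nat_mult_eq_4_cases[of r3 "r2 * b * b'"] nat_mult_eq_4_cases[of b "r2 * r3 * b'"]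
    by (simp_all add: mult_ac)
  \<comment> \<open>The enumeration runs over r1, r2, r3, a, b; the two products equal to 4 then fix
    a' and b', this equation fixes c', and the last relation fixes c.\<close>
  have c': "c' = r2 * a * b div 2"
    using eqs(1) by simp
  show ?thesis
    using \<open>r1 \<in> _\<close> \<open>r2 \<in> _\<close> \<open>r3 \<in> _\<close> \<open>a \<in> _\<close> \<open>b \<in> _\<close> \<open>r1 * r2 * a * a' = 4\<close> \<open>r2 * r3 * b * b' = 4\<close>
      eqs c'
    by (elim insertE emptyE) (simp_all add: normal_tuples_def)
qed

section \<open>Classification\<close>

definition palindromic :: "nat \<Rightarrow> nat poly \<Rightarrow> bool" where
  "palindromic r p \<longleftrightarrow> degree p \<le> r \<and> (\<forall>i\<le>r. coeff p i = coeff p (r - i)) \<and>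
     coeff p 0 = 1 \<and> coeff p r = 1"

lemma palindromicD:
  assumes "palindromic r p"
  shows "degree p \<le> r" "coeff p 0 = 1" "coeff p r = 1"
    "i \<le> r \<Longrightarrow> coeff p i = coeff p (r - i)"
  using assms unfolding palindromic_def by blast+

lemma palindromic_1:
  assumes "palindromic 1 p"
  shows "p = [:1, 1:]"
proof (rule poly_eqI)
  fix n :: nat
  consider "n = 0" | "n = 1" | "n > 1" by linarith
  then show "coeff p n = coeff [:1, 1:] n"
    using palindromicD(1-3)[OF assms]
    by cases (simp_all add: coeff_pCons coeff_eq_0 split: nat.split)
qed

lemma palindromic_2:
  assumes "palindromic 2 p"
  shows "p = [:1, coeff p 1, 1:]"
proof (rule poly_eqI)
  fix n :: nat
  consider "n = 0" | "n = 1" | "n = 2" | "n > 2" by linarith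
  then show "coeff p n = coeff [:1, coeff p 1, 1:] n"
    using palindromicD(1-3)[OF assms]
    by cases (simp_all add: coeff_pCons coeff_eq_0 split: nat.split)
qed

lemma palindromic_4:
  assumes "palindromic 4 p"
  shows "p = [:1, coeff p 1, coeff p 2, coeff p 1, 1:]"
proof (rule poly_eqI)
  fix n :: nat
  have 3: "coeff p 3 = coeff p 1"
    using palindromicD(4)[OF assms, of 3] by simp
  consider "n = 0" | "n = 1" | "n = 2" | "n = 3" | "n = 4" | "n > 4" by linarith
  then show "coeff p n = coeff [:1, coeff p 1, coeff p 2, coeff p 1, 1:] n"
    using 3 palindromicD(1-3)[OF assms]
    by cases (simp_all add: coeff_pCons coeff_eq_0 split: nat.split)
qed

text \<open>The hypotheses with the symmetry condition turned into relations on the matrix; in this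
  form they are stable under permutation and negation.\<close>

definition regular_seed :: "'k::field_char_0 seed \<Rightarrow> bool" where
  "regular_seed \<Omega> \<longleftrightarrow> free_generators (cluster \<Omega>) \<and>
     (\<forall>s. palindromic (degs \<Omega> $ s) (polys \<Omega> $ s)) \<and> reversed_by_mutations (degs \<Omega>) (exch \<Omega>)"

lemma regular_seed_permute:
  "regular_seed \<Omega> \<Longrightarrow> bij \<sigma> \<Longrightarrow> regular_seed (permute_seed \<sigma> \<Omega>)"
  by (simp add: regular_seed_def permute_seed_def free_generators_permute
      reversed_by_mutations_permute)

lemma regular_seed_opposite: "regular_seed \<Omega> \<Longrightarrow> regular_seed (opposite \<Omega>)"
  by (simp add: regular_seed_def reversed_by_mutations_uminus)

definition listed :: "'k::field_char_0 seed \<Rightarrow> bool" where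
  "listed \<Omega> \<longleftrightarrow> (\<exists>i\<in>{1..10}. \<exists>\<Omega>\<^sub>i \<sigma>. Omega3 i \<Omega>\<^sub>i \<and> bij \<sigma> \<and>
     (\<Omega> = permute_seed \<sigma> \<Omega>\<^sub>i \<or> \<Omega> = permute_seed \<sigma> (opposite \<Omega>\<^sub>i)))"

lemma Omega3_listed:
  assumes "Omega3 i \<Omega>"
  shows "listed \<Omega>"
proof -
  have "i \<in> {1..10}"
    using assms by cases auto
  with assms show ?thesis
    unfolding listed_def by (metis bij_id permute_seed_id)
qed

lemma listed_permuteD:
  assumes "listed (permute_seed \<sigma> \<Omega>)" "bij \<sigma>"
  shows "listed \<Omega>"
proof -
  obtain \<tau> where \<tau>: "\<sigma> \<circ> \<tau> = id" "bij \<tau>"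
    using assms(2) by (metis bij_imp_bij_inv bij_is_surj surj_iff)
  obtain i \<Omega>' \<rho> where i: "i \<in> {1..10}" "Omega3 i \<Omega>'" "bij \<rho>"
    and eq: "permute_seed \<sigma> \<Omega> = permute_seed \<rho> \<Omega>' \<or> permute_seed \<sigma> \<Omega> = permute_seed \<rho> (opposite \<Omega>')"
    using assms(1) unfolding listed_def by blast
  have "permute_seed \<tau> (permute_seed \<sigma> \<Omega>) = \<Omega>"
    by (simp add: permute_seed_permute_seed \<tau>)
  with eq have "\<Omega> = permute_seed (\<rho> \<circ> \<tau>) \<Omega>' \<or> \<Omega> = permute_seed (\<rho> \<circ> \<tau>) (opposite \<Omega>')"
    by (metis permute_seed_permute_seed)
  moreover have "bij (\<rho> \<circ> \<tau>)"
    using i \<tau> by (simp add: bij_comp)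
  ultimately show ?thesis
    unfolding listed_def using i by blast
qed

lemma opposite_permute: "opposite (permute_seed \<sigma> \<Omega>) = permute_seed \<sigma> (opposite \<Omega>)"
  by (simp add: opposite_def permute_seed_def permute_matrix_def vec_eq_iff)

lemma listed_oppositeD:
  assumes "listed (opposite \<Omega>)"
  shows "listed \<Omega>"
proof -
  obtain i \<Omega>' \<rho> where i: "i \<in> {1..10}" "Omega3 i \<Omega>'" "bij \<rho>"
    and eq: "opposite \<Omega> = permute_seed \<rho> \<Omega>' \<or> opposite \<Omega> = permute_seed \<rho> (opposite \<Omega>')"
    using assms unfolding listed_def by blast
  then have "\<Omega> = permute_seed \<rho> (opposite \<Omega>') \<or> \<Omega> = permute_seed \<rho> \<Omega>'"
    by (metis opposite_permute opposite_simps(5))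
  then show ?thesis
    unfolding listed_def using i by blast
qed

lemma listed_has_invariant:
  assumes "listed \<Omega>" "regular_seed \<Omega>"
  shows "has_invariant \<Omega>"
proof -
  obtain i \<Omega>' \<sigma> where i: "Omega3 i \<Omega>'" "bij \<sigma>"
    and eq: "\<Omega> = permute_seed \<sigma> \<Omega>' \<or> \<Omega> = permute_seed \<sigma> (opposite \<Omega>')"
    using assms(1) unfolding listed_def by blast
  have inv: "has_invariant (permute_seed \<sigma> \<Omega>')"
    using i by (intro has_invariant_permute Omega3_has_invariant)
  from eq show ?thesis
  proof
    assume "\<Omega> = permute_seed \<sigma> \<Omega>'"
    then show ?thesis using inv by simp
  next
    assume "\<Omega> = permute_seed \<sigma> (opposite \<Omega>')"
    then have \<Omega>: "\<Omega> = opposite (permute_seed \<sigma> \<Omega>')"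
      by (simp add: opposite_permute)
    \<comment> \<open>This seed is the opposite of \<Omega>; its regularity supplies the palindromic
      coefficients for \<open>has_invariant_opposite\<close>.\<close>
    have "regular_seed (permute_seed \<sigma> \<Omega>')"
      using regular_seed_opposite[OF assms(2)] by (simp add: \<Omega>)
    then show ?thesis
      unfolding \<Omega> regular_seed_def palindromic_def
      by (intro has_invariant_opposite inv) blast
  qed
qed

definition normal_tuple :: "'k seed \<Rightarrow> nat \<times> nat \<times> nat \<times> int \<times> int \<times> int \<times> int \<times> int \<times> int" where
  "normal_tuple \<Omega> = (degs \<Omega> $ 1, degs \<Omega> $ 2, degs \<Omega> $ 3,
     exch \<Omega> $ 1 $ 2, exch \<Omega> $ 2 $ 3, exch \<Omega> $ 3 $ 1,
     - exch \<Omega> $ 2 $ 1, - exch \<Omega> $ 3 $ 2, - exch \<Omega> $ 1 $ 3)"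

text \<open>The tuple fixes the degrees and the off-diagonal entries, the diagonal is zero, and
  palindromicity leaves only the free parameters of the exchange polynomials.\<close>

lemma listed_tuple:
  assumes "regular_seed \<Omega>" "normal_tuple \<Omega> \<in> normal_tuples - {(2,1,1, 1,4,1, 2,1,2)}"
  shows "listed \<Omega>"
proof -
  have diag: "exch \<Omega> $ i $ i = 0" for i
    using assms(1) by (simp add: regular_seed_def reversed_by_mutations_def)
  have free: "free_generators (cluster \<Omega>)" and pal: "\<And>s. palindromic (degs \<Omega> $ s) (polys \<Omega> $ s)"
    using assms(1) by (simp_all add: regular_seed_def)
  have deg1: "polys \<Omega> $ s = [:1, 1:]" if "degs \<Omega> $ s = 1" for s
    by (rule palindromic_1) (use pal[of s] that in simp)
  define k k2
    where "k s = coeff (polys \<Omega> $ s) 1" and "k2 s = coeff (polys \<Omega> $ s) 2" for s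
  have deg2: "polys \<Omega> $ s = [:1, k s, 1:]" if "degs \<Omega> $ s = 2" for s
    unfolding k_def by (rule palindromic_2) (use pal[of s] that in simp)
  have deg4: "polys \<Omega> $ s = [:1, k s, k2 s, k s, 1:]" if "degs \<Omega> $ s = 4" for s
    unfolding k_def k2_def by (rule palindromic_4) (use pal[of s] that in simp)
  note eqs = vec_eq_iff forall_3 mat3_def diag deg1 deg2 deg4
  have neg: "- x = y \<longleftrightarrow> x = - y" for x y :: int by auto
  consider
      "normal_tuple \<Omega> = (1,1,1, 2,2,2, 2,2,2)" | "normal_tuple \<Omega> = (1,1,2, 2,1,2, 2,2,1)"
    | "normal_tuple \<Omega> = (2,1,2, 2,1,1, 1,2,1)" | "normal_tuple \<Omega> = (2,2,2, 1,1,1, 1,1,1)"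
    | "normal_tuple \<Omega> = (1,1,1, 1,2,4, 4,2,1)" | "normal_tuple \<Omega> = (2,1,1, 1,2,2, 2,2,1)"
    | "normal_tuple \<Omega> = (4,1,1, 1,2,1, 1,2,1)" | "normal_tuple \<Omega> = (1,1,1, 4,2,1, 1,2,4)"
    | "normal_tuple \<Omega> = (1,2,1, 2,2,1, 1,1,4)" | "normal_tuple \<Omega> = (1,2,2, 2,1,1, 1,1,2)"
    using assms(2) unfolding normal_tuples_def by blast
  then show ?thesis
  proof cases
    case 1
    then have "\<Omega> = \<lparr>exch = mat3 [0, 2, -2] [-2, 0, 2] [2, -2, 0], cluster = cluster \<Omega>,
        degs = vector [1, 1, 1], polys = vector [[:1, 1:], [:1, 1:], [:1, 1:]]\<rparr>"
      unfolding normal_tuple_def by (intro seed.equality) (simp_all add: eqs neg)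
    then show ?thesis by (metis Omega3.intros(1)[OF free] Omega3_listed)
  next
    case 2
    then have "\<Omega> = \<lparr>exch = mat3 [0, 2, -1] [-2, 0, 1] [2, -2, 0], cluster = cluster \<Omega>,
        degs = vector [1, 1, 2], polys = vector [[:1, 1:], [:1, 1:], [:1, k 3, 1:]]\<rparr>"
      unfolding normal_tuple_def by (intro seed.equality) (simp_all add: eqs neg)
    then show ?thesis by (metis Omega3.intros(2)[OF free] Omega3_listed)
  next
    case 3
    then have "\<Omega> = \<lparr>exch = mat3 [0, 2, -1] [-1, 0, 1] [1, -2, 0], cluster = cluster \<Omega>,
        degs = vector [2, 1, 2], polys = vector [[:1, k 1, 1:], [:1, 1:], [:1, k 3, 1:]]\<rparr>"
      unfolding normal_tuple_def by (intro seed.equality) (simp_all add: eqs neg)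
    then show ?thesis by (metis Omega3.intros(3)[OF free] Omega3_listed)
  next
    case 4
    then have "\<Omega> = \<lparr>exch = mat3 [0, 1, -1] [-1, 0, 1] [1, -1, 0], cluster = cluster \<Omega>,
        degs = vector [2, 2, 2], polys = vector [[:1, k 1, 1:], [:1, k 2, 1:], [:1, k 3, 1:]]\<rparr>"
      unfolding normal_tuple_def by (intro seed.equality) (simp_all add: eqs neg)
    then show ?thesis by (metis Omega3.intros(4)[OF free] Omega3_listed)
  next
    case 5
    then have "\<Omega> = \<lparr>exch = mat3 [0, 1, -1] [-4, 0, 2] [4, -2, 0], cluster = cluster \<Omega>,
        degs = vector [1, 1, 1], polys = vector [[:1, 1:], [:1, 1:], [:1, 1:]]\<rparr>"
      unfolding normal_tuple_def by (intro seed.equality) (simp_all add: eqs neg)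
    then show ?thesis by (metis Omega3.intros(5)[OF free] Omega3_listed)
  next
    case 6
    then have "\<Omega> = \<lparr>exch = mat3 [0, 1, -1] [-2, 0, 2] [2, -2, 0], cluster = cluster \<Omega>,
        degs = vector [2, 1, 1], polys = vector [[:1, k 1, 1:], [:1, 1:], [:1, 1:]]\<rparr>"
      unfolding normal_tuple_def by (intro seed.equality) (simp_all add: eqs neg)
    then show ?thesis by (metis Omega3.intros(6)[OF free] Omega3_listed)
  next
    case 7
    then have "\<Omega> = \<lparr>exch = mat3 [0, 1, -1] [-1, 0, 2] [1, -2, 0], cluster = cluster \<Omega>,
        degs = vector [4, 1, 1], polys = vector [[:1, k 1, k2 1, k 1, 1:], [:1, 1:], [:1, 1:]]\<rparr>"
      unfolding normal_tuple_def by (intro seed.equality) (simp_all add: eqs neg)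
    then show ?thesis by (metis Omega3.intros(7)[OF free] Omega3_listed)
  next
    case 8
    then have "\<Omega> = \<lparr>exch = mat3 [0, 4, -4] [-1, 0, 2] [1, -2, 0], cluster = cluster \<Omega>,
        degs = vector [1, 1, 1], polys = vector [[:1, 1:], [:1, 1:], [:1, 1:]]\<rparr>"
      unfolding normal_tuple_def by (intro seed.equality) (simp_all add: eqs neg)
    then show ?thesis by (metis Omega3.intros(8)[OF free] Omega3_listed)
  next
    case 9
    then have "\<Omega> = \<lparr>exch = mat3 [0, 2, -4] [-1, 0, 2] [1, -1, 0], cluster = cluster \<Omega>,
        degs = vector [1, 2, 1], polys = vector [[:1, 1:], [:1, k 2, 1:], [:1, 1:]]\<rparr>"
      unfolding normal_tuple_def by (intro seed.equality) (simp_all add: eqs neg)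
    then show ?thesis by (metis Omega3.intros(9)[OF free] Omega3_listed)
  next
    case 10
    then have "\<Omega> = \<lparr>exch = mat3 [0, 2, -2] [-1, 0, 1] [1, -1, 0], cluster = cluster \<Omega>,
        degs = vector [1, 2, 2], polys = vector [[:1, 1:], [:1, k 2, 1:], [:1, k 3, 1:]]\<rparr>"
      unfolding normal_tuple_def by (intro seed.equality) (simp_all add: eqs neg)
    then show ?thesis by (metis Omega3.intros(10)[OF free] Omega3_listed)
  qed
qed

lemma listed_normal_tuple:
  assumes "regular_seed \<Omega>" "normal_tuple \<Omega> \<in> normal_tuples"
  shows "listed \<Omega>"
proof (cases "normal_tuple \<Omega> = (2,1,1, 1,4,1, 2,1,2)")
  case True
  \<comment> \<open>Negation reverses the cyclic sign pattern and exchanging 1 and 2 restores it,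
    which leads to the ninth tuple.\<close>
  let ?\<sigma> = "Transposition.transpose (1::3) 2"
  let ?\<Omega> = "permute_seed ?\<sigma> (opposite \<Omega>)"
  have "?\<sigma> 1 = 2" "?\<sigma> 2 = 1" "?\<sigma> 3 = 3"
    by (simp_all add: Transposition.transpose_def)
  with True have "normal_tuple ?\<Omega> = (1,2,1, 2,2,1, 1,1,4)"
    by (simp add: normal_tuple_def permute_seed_def permute_matrix_def)
  then have "listed ?\<Omega>"
    using assms(1)
    by (intro listed_tuple regular_seed_permute regular_seed_opposite)
      (simp_all add: normal_tuples_def)
  then have "listed (opposite \<Omega>)"
    by (rule listed_permuteD) simp
  then show ?thesis
    by (rule listed_oppositeD)
next
  case False
  with assms show ?thesis
    by (intro listed_tuple) simp_all
qed

lemma regular_seed_listed: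
  fixes \<Omega> :: "'k::field_char_0 seed"
  assumes "regular_seed \<Omega>"
  shows "listed \<Omega>"
proof -
  have pos: "listed \<Omega>" if reg: "regular_seed \<Omega>" and "exch \<Omega> $ 1 $ 2 > 0" for \<Omega> :: "'k seed"
  proof -
    let ?B = "exch \<Omega>" and ?r = "degs \<Omega>"
    have rev: "reversed_by_mutations ?r ?B"
      using reg by (simp add: regular_seed_def)
    have prod: "?B $ i $ j * ?B $ j $ i < 0" if "i \<noteq> j" for i j
      using rev that unfolding reversed_by_mutations_def by blast
    have rel: "int (?r $ j) * ?B $ i $ j * \<bar>?B $ j $ k\<bar> = - 2 * ?B $ i $ k"
      if "distinct [i, j, k]" for i j k
      using rev that unfolding reversed_by_mutations_def by blast
    \<comment> \<open>The relation r_j b_ij |b_jk| = -2 b_ik carries signs around the triangle: from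
      b_12 > 0 follows b_31 > 0, and then b_23 > 0.\<close>
    have neg: "?B $ i $ k < 0" and pos: "?B $ k $ i > 0"
      if "distinct [i, j, k]" "?B $ i $ j > 0" for i j k
    proof -
      have "0 \<le> int (?r $ j) * ?B $ i $ j * \<bar>?B $ j $ k\<bar>"
        using that(2) by simp
      then have "0 \<le> - 2 * ?B $ i $ k"
        unfolding rel[OF that(1)] .
      moreover have prod_ik: "?B $ i $ k * ?B $ k $ i < 0"
        using that(1) by (intro prod) auto
      ultimately show "?B $ i $ k < 0"
        by (cases "?B $ i $ k = 0") auto
      with prod_ik show "?B $ k $ i > 0"
        by (simp add: mult_less_0_iff)
    qed
    have 13: "?B $ 1 $ 3 < 0" "?B $ 3 $ 1 > 0"
      using neg[of 1 2 3] pos[of 1 2 3] that(2) by simp_all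
    have 32: "?B $ 3 $ 2 < 0" "?B $ 2 $ 3 > 0"
      using neg[of 3 1 2] pos[of 3 1 2] 13 by simp_all
    have 21: "?B $ 2 $ 1 < 0" "?B $ 1 $ 2 > 0"
      using neg[of 2 3 1] 32 that(2) by simp_all
    define a b c where abc: "a = nat (?B $ 1 $ 2)" "b = nat (?B $ 2 $ 3)" "c = nat (?B $ 3 $ 1)"
    define a' b' c'
      where abc': "a' = nat (- ?B $ 2 $ 1)" "b' = nat (- ?B $ 3 $ 2)" "c' = nat (- ?B $ 1 $ 3)"
    have int: "?B $ 1 $ 2 = int a" "?B $ 2 $ 3 = int b" "?B $ 3 $ 1 = int c"
      "?B $ 2 $ 1 = - int a'" "?B $ 3 $ 2 = - int b'" "?B $ 1 $ 3 = - int c'"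
      using 13 32 21 by (simp_all add: abc abc')
    have "int (?r $ 2 * a * b) = int (2 * c')" "int (?r $ 3 * b * c) = int (2 * a')"
      "int (?r $ 1 * c * a) = int (2 * b')" "int (?r $ 3 * c' * b') = int (2 * a)"
      "int (?r $ 1 * a' * c') = int (2 * b)" "int (?r $ 2 * b' * a') = int (2 * c)"
      using rel[of 1 2 3] rel[of 2 3 1] rel[of 3 1 2] rel[of 1 3 2] rel[of 2 1 3] rel[of 3 2 1]
      by (simp_all add: int)
    note eqs = this[unfolded of_nat_eq_iff]
    \<comment> \<open>The cyclic rotation is addition of 1 modulo 3.\<close>
    obtain \<rho> :: "3 \<Rightarrow> 3" where rot: "\<rho> 1 = 2" "\<rho> 2 = 3" "\<rho> 3 = 1" and "bij \<rho>"
      by (rule that[of "\<lambda>i. i + 1"]) (simp_all add: bij_plus_right)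
    have "normal_tuple \<Omega> \<in> normal_tuples \<or> normal_tuple (permute_seed \<rho> \<Omega>) \<in> normal_tuples \<or>
        normal_tuple (permute_seed \<rho> (permute_seed \<rho> \<Omega>)) \<in> normal_tuples"
      using rotate_to_normal_tuple[OF eqs] 13 32 21
      by (simp add: normal_tuple_def permute_seed_def permute_matrix_def rot int)
    then show ?thesis
    proof (elim disjE)
      assume "normal_tuple \<Omega> \<in> normal_tuples"
      then show ?thesis by (rule listed_normal_tuple[OF reg])
    next
      assume "normal_tuple (permute_seed \<rho> \<Omega>) \<in> normal_tuples"
      then have "listed (permute_seed \<rho> \<Omega>)"
        using reg \<open>bij \<rho>\<close> by (intro listed_normal_tuple regular_seed_permute)
      then show ?thesis
        using \<open>bij \<rho>\<close> by (rule listed_permuteD)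
    next
      assume "normal_tuple (permute_seed \<rho> (permute_seed \<rho> \<Omega>)) \<in> normal_tuples"
      then have "listed (permute_seed \<rho> (permute_seed \<rho> \<Omega>))"
        using reg \<open>bij \<rho>\<close> by (intro listed_normal_tuple regular_seed_permute)
      then show ?thesis
        by (rule listed_permuteD[OF listed_permuteD[OF _ \<open>bij \<rho>\<close>] \<open>bij \<rho>\<close>])
    qed
  qed
  have "exch \<Omega> $ 1 $ 2 * exch \<Omega> $ 2 $ 1 < 0"
    using assms by (simp add: regular_seed_def reversed_by_mutations_def)
  then have "exch \<Omega> $ 1 $ 2 \<noteq> 0" by auto
  \<comment> \<open>Passing to the opposite seed normalizes the sign of b_12.\<close>
  then consider "exch \<Omega> $ 1 $ 2 > 0" | "exch (opposite \<Omega>) $ 1 $ 2 > 0"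
    by (cases "exch \<Omega> $ 1 $ 2 > 0") simp_all
  then show ?thesis
    using pos[OF assms] pos[OF regular_seed_opposite[OF assms]] listed_oppositeD by cases blast+
qed

theorem theorem1p6:
  fixes \<Omega> :: "ratfun3 seed"
  assumes "is_seed \<Omega>"
    and "irreducible_matrix (exch \<Omega>)"
    and "mutate 1 \<in> cluster_symmetries \<Omega>"
    and "mutate 2 \<in> cluster_symmetries \<Omega>"
    and "mutate 3 \<in> cluster_symmetries \<Omega>"
  shows "invariant_ring \<Omega> \<noteq> constant_laurent3 \<longleftrightarrow>
    (\<exists>i\<in>{1..10}. \<exists>\<Omega>\<^sub>i \<sigma>. Omega3 i \<Omega>\<^sub>i \<and> bij \<sigma> \<and>
       (\<Omega> = permute_seed \<sigma> \<Omega>\<^sub>i \<or> \<Omega> = permute_seed \<sigma> (opposite \<Omega>\<^sub>i)))"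
proof -
  have "\<forall>s. mutate s \<in> cluster_symmetries \<Omega>"
    using assms(3-5) by (simp add: forall_3)
  then have "reversed_by_mutations (degs \<Omega>) (exch \<Omega>)"
    using assms(1,2) cluster_symmetry_exch
    by (intro reversed_by_mutationsI) (auto simp: is_seed_def)
  moreover have pal: "palindromic (degs \<Omega> $ s) (polys \<Omega> $ s)" for s
    using assms(1) unfolding is_seed_def palindromic_def by blast
  moreover have free: "free_generators (cluster \<Omega>)"
    using assms(1) by (simp add: is_seed_def)
  ultimately have reg: "regular_seed \<Omega>"
    by (simp add: regular_seed_def)
  have "invariant_ring \<Omega> \<noteq> constant_laurent3"
  proof (rule invariant_ring_nonconstant)
    show "has_invariant \<Omega>"
      using reg by (intro listed_has_invariant regular_seed_listed)
    show "exch \<Omega> $ s $ s = 0" for s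
      using reg by (simp add: regular_seed_def reversed_by_mutations_def)
    show "coeff (polys \<Omega> $ s) 0 = 1" for s
      by (rule palindromicD(2)[OF pal])
  qed (rule free)
  moreover have "listed \<Omega>"
    using reg by (rule regular_seed_listed)
  ultimately show ?thesis
    unfolding listed_def by blast
qed

end
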